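(* Let $(G,<,\mathbf{q})$ be a stable assignment instance, let $X\in\{A,B\}$ and let $Y$ be the other side. Algorithm $X$-rotate-remove (described below), for any choice made between cases (i) and (ii) at each iteration, terminates and outputs the $Y$-optimal legal assignment; i.e., for $Y=A$ it outputs the legal assignment $M^*$ with $M^*\succeq M$ for every legal $M$, and for $Y=B$ the legal assignment $M^*$ with $M\succeq M^*$ for every legal $M$.
   Context: Setting: $G=(A\cup B,E)$ finite simple bipartite graph (students $A$, schools $B$); $<_v$ a strict total order on the neighbours of each vertex $v$ (write $y>_x y'$, $y\ge_x y'$, and $y>_x\emptyset$ for each neighbour $y$); positive integer quotas $q_b$ for $b\in B$ and $q_a=1$ for $a\in A$. An assignment is $M\subseteq E$ with each vertex $v$ in at most $q_v$ edges; $M(x)=\{y:xy\in M\}$ (for a student, identified with its element or $\emptyset$). Edge $ab$ blocks $M$ if $b>_a M(a)$ and either $|M(b)|<q_b$ or $a>_b a'$ for some $a'\in M(b)$; an assignment blocks $M$ if one of its edges does; $M$ is stable if no edge of the graph blocks it. A set $\mathcal{L}$ of assignments has the legal property if the assignments blocked by some member of $\mathcal{L}$ are exactly those not in $\mathcal{L}$; there is exactly one such set, the legal assignments. $M\succeq M'$ means $M(a)\ge_a M'(a)$ for all $a\in A$. The student-optimal (resp. school-optimal) stable assignment is the stable $M$ with $M\succeq M'$ (resp. $M'\succeq M$) for all stable $M'$. For a subgraph $G'$, $(G',<,\mathbf{q})$ has preferences restricted to $G'$. Rotations: for stable $M$ in an instance and $x\in X$, $s_M(x)$ is the most preferred agent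 $y$ in $x$'s list (in that instance) with $y\notin M(x)$ and $x>_y x'$ for some $x'\in M(y)$ (may not exist); if it exists and $|M(y)|=q_y$, $next_M(x)$ is the $<_y$-least element of $M(y)$, and if $|M(y)|<q_y$, $next_M(x)=\emptyset$. The $X$-rotation digraph of $M$ has vertices $X\cup Y\cup\{\emptyset\}$ and arcs $(x,s_M(x)),(s_M(x),next_M(x))$ for each $x\in X$ with $s_M(x)$ defined. A directed cycle of it corresponds to an $X$-rotation $\rho=y_0,x_0,y_1,x_1,\dots,y_{r-1},x_{r-1}$ with $x_iy_i\in M$, $s_M(x_i)=y_{i+1}$ (indices mod $r$); $M/\rho$ is obtained from $M$ by replacing each $x_iy_i$ with $x_iy_{i+1}$. Algorithm $X$-rotate-remove: let $M^0$ be the $Y$-optimal stable assignment of $(G,<,\mathbf{q})$, $G^0=G$, $i=0$, $D^0$ the $X$-rotation digraph of $M^0$ in $(G^0,<,\mathbf{q})$. While $D^i$ has an arc: find either (i) arcs $(x',y),(y,x)$ of $D^i$ with $x$ a sink of $D^i$, or (ii) a directed cycle of $D^i$ (if both exist, either may be chosen). In case (i), $G^{i+1}$ is $G^i$ with edge $x'y$ removed and $M^{i+1}=M^i$; in case (ii), with $\rho^i$ the corresponding $X$-rotation, $M^{i+1}=M^i/\rho^i$ and $G^{i+1}=G^i$. Set $i:=i+1$ and let $D^i$ be the $X$-rotation digraph of $M^i$ in $(G^i,<,\mathbf{q})$. When $D^i$ has no arc, output $M^i$. *)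

theory Defs
  imports "Graph_Theory.Pair_Digraph" "Graph_Theory.Arc_Walk"
begin

text \<open>Edges are two-element sets \<open>{a, b}\<close>. For each vertex \<open>v\<close>, the relation \<open>pref_less I v\<close> is
  \<open><\<^sub>v\<close>: \<open>(y', y) \<in> pref_less I v\<close> means that \<open>v\<close> strictly prefers \<open>y\<close> to \<open>y'\<close>.\<close>

record 'v sa_instance =
  students :: "'v set"
  schools :: "'v set"
  edges :: "'v set set"
  pref_less :: "'v \<Rightarrow> 'v rel"
  quota :: "'v \<Rightarrow> nat"

definition mates :: "'v set set \<Rightarrow> 'v \<Rightarrow> 'v set" where
  "mates M v = {w. {v, w} \<in> M}"

definition stable_assignment_instance :: "'v sa_instance \<Rightarrow> bool" where
  "stable_assignment_instance I \<longleftrightarrow>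
     finite (students I) \<and> finite (schools I) \<and> students I \<inter> schools I = {} \<and>
     edges I \<subseteq> {{a, b} |a b. a \<in> students I \<and> b \<in> schools I} \<and>
     (\<forall>v \<in> students I \<union> schools I.
        pref_less I v \<subseteq> mates (edges I) v \<times> mates (edges I) v \<and>
        strict_linear_order_on (mates (edges I) v) (pref_less I v)) \<and>
     (\<forall>a \<in> students I. quota I a = 1) \<and>
     (\<forall>b \<in> schools I. quota I b > 0)"

definition restrict_edges :: "'v sa_instance \<Rightarrow> 'v set set \<Rightarrow> 'v sa_instance" where
  "restrict_edges I F =
     I\<lparr>edges := F, pref_less := (\<lambda>v. pref_less I v \<inter> (mates F v \<times> mates F v))\<rparr>"

definition assignment :: "'v sa_instance \<Rightarrow> 'v set set \<Rightarrow> bool" where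
  "assignment I M \<longleftrightarrow> M \<subseteq> edges I \<and>
     (\<forall>v \<in> students I \<union> schools I. card {e \<in> M. v \<in> e} \<le> quota I v)"

text \<open>The empty agent \<open>\<emptyset>\<close> is \<open>None\<close>, both as the partner of an unassigned student and as a
  vertex of the rotation digraph.\<close>

definition partner :: "'v set set \<Rightarrow> 'v \<Rightarrow> 'v option" where
  "partner M a = (if mates M a = {} then None else Some (the_elem (mates M a)))"

fun prefers :: "'v sa_instance \<Rightarrow> 'v \<Rightarrow> 'v option \<Rightarrow> 'v option \<Rightarrow> bool" where
  "prefers I v (Some y) (Some y') \<longleftrightarrow> (y', y) \<in> pref_less I v"
| "prefers I v (Some y) None \<longleftrightarrow> y \<in> mates (edges I) v"
| "prefers I v None _ \<longleftrightarrow> False"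

definition prefers_eq :: "'v sa_instance \<Rightarrow> 'v \<Rightarrow> 'v option \<Rightarrow> 'v option \<Rightarrow> bool" where
  "prefers_eq I v y y' \<longleftrightarrow> y = y' \<or> prefers I v y y'"

definition dominates :: "'v sa_instance \<Rightarrow> 'v set set \<Rightarrow> 'v set set \<Rightarrow> bool" where
  "dominates I M M' \<longleftrightarrow> (\<forall>a \<in> students I. prefers_eq I a (partner M a) (partner M' a))"

definition edge_blocks :: "'v sa_instance \<Rightarrow> 'v \<Rightarrow> 'v \<Rightarrow> 'v set set \<Rightarrow> bool" where
  "edge_blocks I a b M \<longleftrightarrow>
     a \<in> students I \<and> b \<in> schools I \<and> {a, b} \<in> edges I \<and>
     prefers I a (Some b) (partner M a) \<and>
     (card (mates M b) < quota I b \<or> (\<exists>a' \<in> mates M b. (a', a) \<in> pref_less I b))"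

definition blocks :: "'v sa_instance \<Rightarrow> 'v set set \<Rightarrow> 'v set set \<Rightarrow> bool" where
  "blocks I M' M \<longleftrightarrow> (\<exists>a b. {a, b} \<in> M' \<and> edge_blocks I a b M)"

definition stable :: "'v sa_instance \<Rightarrow> 'v set set \<Rightarrow> bool" where
  "stable I M \<longleftrightarrow> assignment I M \<and> \<not> (\<exists>a b. edge_blocks I a b M)"

definition legal_property :: "'v sa_instance \<Rightarrow> 'v set set set \<Rightarrow> bool" where
  "legal_property I L \<longleftrightarrow> L \<subseteq> {M. assignment I M} \<and>
     {M. assignment I M \<and> (\<exists>M' \<in> L. blocks I M' M)} = {M. assignment I M} - L"

definition legal_assignments :: "'v sa_instance \<Rightarrow> 'v set set set" where
  "legal_assignments I = (THE L. legal_property I L)"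

datatype side = Students | Schools

fun opposite :: "side \<Rightarrow> side" where
  "opposite Students = Schools"
| "opposite Schools = Students"

fun agents :: "'v sa_instance \<Rightarrow> side \<Rightarrow> 'v set" where
  "agents I Students = students I"
| "agents I Schools = schools I"

text \<open>Optimality for the schools is, by definition, pessimality for the students.\<close>

fun optimal_in :: "'v sa_instance \<Rightarrow> side \<Rightarrow> 'v set set set \<Rightarrow> 'v set set \<Rightarrow> bool" where
  "optimal_in I Students S M \<longleftrightarrow> M \<in> S \<and> (\<forall>M' \<in> S. dominates I M M')"
| "optimal_in I Schools S M \<longleftrightarrow> M \<in> S \<and> (\<forall>M' \<in> S. dominates I M' M)"

definition optimal_stable :: "'v sa_instance \<Rightarrow> side \<Rightarrow> 'v set set" where
  "optimal_stable I Y = (THE M. optimal_in I Y {M. stable I M} M)"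

definition succ_candidates :: "'v sa_instance \<Rightarrow> 'v set set \<Rightarrow> 'v \<Rightarrow> 'v set" where
  "succ_candidates I M x =
     {y \<in> mates (edges I) x. y \<notin> mates M x \<and> (\<exists>x' \<in> mates M y. (x', x) \<in> pref_less I y)}"

text \<open>\<open>rot_succ I M x\<close> is \<open>s\<^sub>M(x)\<close>, with \<open>None\<close> if it does not exist; \<open>rot_next I M x\<close> is
  \<open>next\<^sub>M(x)\<close>, with \<open>None\<close> for \<open>\<emptyset>\<close> (it is only used where \<open>s\<^sub>M(x)\<close> exists).\<close>

definition rot_succ :: "'v sa_instance \<Rightarrow> 'v set set \<Rightarrow> 'v \<Rightarrow> 'v option" where
  "rot_succ I M x =
     (if succ_candidates I M x = {} then None
      else Some (THE y. y \<in> succ_candidates I M x \<and>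
                        (\<forall>y' \<in> succ_candidates I M x. y' = y \<or> (y', y) \<in> pref_less I x)))"

definition rot_next :: "'v sa_instance \<Rightarrow> 'v set set \<Rightarrow> 'v \<Rightarrow> 'v option" where
  "rot_next I M x = (case rot_succ I M x of
       None \<Rightarrow> None
     | Some y \<Rightarrow>
         if card (mates M y) = quota I y
         then Some (THE z. z \<in> mates M y \<and> (\<forall>z' \<in> mates M y. z' = z \<or> (z, z') \<in> pref_less I y))
         else None)"

definition rotation_digraph ::
    "'v sa_instance \<Rightarrow> side \<Rightarrow> 'v set set \<Rightarrow> 'v option pair_pre_digraph" where
  "rotation_digraph I X M =
     \<lparr>pverts = Some ` (students I \<union> schools I) \<union> {None},
      parcs = {(Some x, Some y) |x y. x \<in> agents I X \<and> rot_succ I M x = Some y} \<union>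
              {(Some y, rot_next I M x) |x y. x \<in> agents I X \<and> rot_succ I M x = Some y}\<rparr>"

definition is_sink :: "'a pair_pre_digraph \<Rightarrow> 'a \<Rightarrow> bool" where
  "is_sink D v \<longleftrightarrow> v \<in> pverts D \<and> out_arcs (with_proj D) v = {}"

text \<open>A rotation \<open>y\<^sub>0, x\<^sub>0, \<dots>, y\<^sub>r\<^sub>-\<^sub>1, x\<^sub>r\<^sub>-\<^sub>1\<close> is the list of its pairs \<open>(y\<^sub>i, x\<^sub>i)\<close>. The corresponding
  cycle is the arc list \<open>(y\<^sub>0, x\<^sub>0), (x\<^sub>0, y\<^sub>1), (y\<^sub>1, x\<^sub>1), \<dots>, (x\<^sub>r\<^sub>-\<^sub>1, y\<^sub>0)\<close>. The arcs of the rotation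
  digraph already guarantee \<open>x\<^sub>iy\<^sub>i \<in> M\<close> and \<open>s\<^sub>M(x\<^sub>i) = y\<^sub>i\<^sub>+\<^sub>1\<close>.\<close>

definition rotation_arcs :: "('v \<times> 'v) list \<Rightarrow> ('v option \<times> 'v option) list" where
  "rotation_arcs \<rho> = concat (map (\<lambda>i.
     [(Some (fst (\<rho> ! i)), Some (snd (\<rho> ! i))),
      (Some (snd (\<rho> ! i)), Some (fst (\<rho> ! (Suc i mod length \<rho>))))]) [0..<length \<rho>])"

definition is_rotation :: "'v sa_instance \<Rightarrow> side \<Rightarrow> 'v set set \<Rightarrow> ('v \<times> 'v) list \<Rightarrow> bool" where
  "is_rotation I X M \<rho> \<longleftrightarrow>
     set \<rho> \<subseteq> agents I (opposite X) \<times> agents I X \<and>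
     pre_digraph.cycle (with_proj (rotation_digraph I X M)) (rotation_arcs \<rho>)"

definition eliminate :: "'v set set \<Rightarrow> ('v \<times> 'v) list \<Rightarrow> 'v set set" where
  "eliminate M \<rho> =
     (M - {{snd (\<rho> ! i), fst (\<rho> ! i)} |i. i < length \<rho>}) \<union>
     {{snd (\<rho> ! i), fst (\<rho> ! (Suc i mod length \<rho>))} |i. i < length \<rho>}"

text \<open>A state of the algorithm is the pair of the current assignment and the edge set of the
  current subgraph.\<close>

type_synonym 'v rr_state = "'v set set \<times> 'v set set"

definition rr_digraph ::
    "'v sa_instance \<Rightarrow> side \<Rightarrow> 'v rr_state \<Rightarrow> 'v option pair_pre_digraph" where
  "rr_digraph I X \<sigma> = rotation_digraph (restrict_edges I (snd \<sigma>)) X (fst \<sigma>)"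

definition rr_init :: "'v sa_instance \<Rightarrow> side \<Rightarrow> 'v rr_state" where
  "rr_init I X = (optimal_stable I (opposite X), edges I)"

inductive rr_step :: "'v sa_instance \<Rightarrow> side \<Rightarrow> 'v rr_state \<Rightarrow> 'v rr_state \<Rightarrow> bool"
  for I :: "'v sa_instance" and X :: side where
  remove: "rr_step I X (M, F) (M, F - {{x', y}})"
    if "x' \<in> agents I X"
      and "(Some x', Some y) \<in> parcs (rr_digraph I X (M, F))"
      and "(Some y, x) \<in> parcs (rr_digraph I X (M, F))"
      and "is_sink (rr_digraph I X (M, F)) x"
| rotate: "rr_step I X (M, F) (eliminate M \<rho>, F)"
    if "is_rotation (restrict_edges I F) X M \<rho>"

definition rr_reachable :: "'v sa_instance \<Rightarrow> side \<Rightarrow> 'v rr_state \<Rightarrow> bool" where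
  "rr_reachable I X \<sigma> \<longleftrightarrow> (rr_step I X)\<^sup>*\<^sup>* (rr_init I X) \<sigma>"

definition rr_halted :: "'v sa_instance \<Rightarrow> side \<Rightarrow> 'v rr_state \<Rightarrow> bool" where
  "rr_halted I X \<sigma> \<longleftrightarrow> parcs (rr_digraph I X \<sigma>) = {}"

text \<open>Every run is finite, and no run gets stuck before the loop condition fails.\<close>

definition rr_terminates :: "'v sa_instance \<Rightarrow> side \<Rightarrow> bool" where
  "rr_terminates I X \<longleftrightarrow>
     (\<nexists>S. S 0 = rr_init I X \<and> (\<forall>i::nat. rr_step I X (S i) (S (Suc i)))) \<and>
     (\<forall>\<sigma>. rr_reachable I X \<sigma> \<and> \<not> rr_halted I X \<sigma> \<longrightarrow> (\<exists>\<sigma>'. rr_step I X \<sigma> \<sigma>'))"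

definition rr_outputs :: "'v sa_instance \<Rightarrow> side \<Rightarrow> 'v set set \<Rightarrow> bool" where
  "rr_outputs I X M \<longleftrightarrow> (\<exists>F. rr_reachable I X (M, F) \<and> rr_halted I X (M, F))"

end

theory Submission
  imports Defs
begin

text \<open>Call two assignments compatible if neither blocks the other. Counting the students who prefer
  the first one shows that two compatible assignments fill the same number of seats at every school,
  that they agree at every agent who is not full, and that at each school all students in the
  symmetric difference prefer the same one of the two, while the school prefers the other one.

  Let \<open>N\<close> be an assignment, and let \<open>x'\<close> point to \<open>y\<close> in the rotation digraph of \<open>N\<close>, where \<open>y\<close>
  points to a sink \<open>x\<close>. If a compatible \<open>M\<close> contained \<open>x'y\<close>, then \<open>x\<close> would lose \<open>y\<close> on the way from
  \<open>N\<close> to \<open>M\<close>, and its new mate in \<open>M\<close> would be a candidate for \<open>s\<^sub>N(x)\<close>. So the algorithm deletes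
  only edges that are not legal. Eliminating a rotation from a legal assignment gives a legal
  assignment, and when no arcs are left the current assignment is optimal among all legal ones.

  A set is legal exactly if its edge set is a fixed point of the antitone map \<open>covered\<close>, which sends
  an edge set \<open>F\<close> to the union of the assignments that \<open>F\<close> does not block. The least fixed point
  \<open>P\<close> of the square of this map and \<open>Q = covered P\<close> enclose all its fixed points. An edge of \<open>Q\<close>
  lies in an assignment compatible with all stable assignments of \<open>Q\<close>, so rotations lead through such
  stable assignments to one that contains the edge. Hence \<open>P = Q\<close>, and there is exactly one legal
  set.\<close>

section \<open>Compatible assignments\<close>

locale sa_instance =
  fixes I :: "'v sa_instance"
  assumes inst: "stable_assignment_instance I"
begin

abbreviation less_at :: "'v \<Rightarrow> 'v rel" where
  "less_at v \<equiv> pref_less I v"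

abbreviation vertices :: "'v set" where
  "vertices \<equiv> students I \<union> schools I"

text \<open>One formula for both sides: a student has quota 1, so a free seat means being
  unassigned. For a non-mate b along an edge, \<open>admits M a b\<close> is then the condition b
  >_a M(a), as \<open>edge_blocks_iff\<close> confirms.\<close>

definition admits :: "'v set set \<Rightarrow> 'v \<Rightarrow> 'v \<Rightarrow> bool" where
  "admits M v w \<longleftrightarrow> card (mates M v) < quota I v \<or> (\<exists>w' \<in> mates M v. (w', w) \<in> less_at v)"

text \<open>K is an arbitrary edge set, so a whole family of assignments can be tested at once
  through its union. The pair v, w runs over both orientations of an edge, which keeps the two sides
  out of the definition.\<close>

definition unblocked :: "'v set set \<Rightarrow> 'v set set \<Rightarrow> bool" where
  "unblocked K M \<longleftrightarrow> (\<forall>v w. {v, w} \<in> K - M \<longrightarrow> \<not> (admits M v w \<and> admits M w v))"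

lemma finite_students: "finite (students I)"
  and finite_schools: "finite (schools I)"
  and disjoint_sides: "students I \<inter> schools I = {}"
  and quota_student: "a \<in> students I \<Longrightarrow> quota I a = 1"
  using inst by (auto simp: stable_assignment_instance_def)

lemma mem_mates_iff: "w \<in> mates M v \<longleftrightarrow> {v, w} \<in> M"
  by (simp add: mates_def)

lemma mates_sym: "w \<in> mates M v \<longleftrightarrow> v \<in> mates M w"
  by (simp add: mates_def insert_commute)

lemma mates_mono: "M \<subseteq> N \<Longrightarrow> mates M v \<subseteq> mates N v"
  by (auto simp: mates_def)

lemma edge_sides:
  assumes "{v, w} \<in> edges I"
  shows "v \<in> students I \<and> w \<in> schools I \<or> v \<in> schools I \<and> w \<in> students I"
proof -
  have "edges I \<subseteq> {{a, b} |a b. a \<in> students I \<and> b \<in> schools I}"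
    using inst by (simp add: stable_assignment_instance_def)
  then show ?thesis using assms by (auto simp: doubleton_eq_iff)
qed

lemma edge_obtain:
  assumes "e \<in> edges I"
  obtains a b where "e = {a, b}" "a \<in> students I" "b \<in> schools I"
proof -
  have "edges I \<subseteq> {{a, b} |a b. a \<in> students I \<and> b \<in> schools I}"
    using inst by (simp add: stable_assignment_instance_def)
  then show ?thesis using assms that by auto
qed

lemma finite_edges: "finite (edges I)"
proof (rule finite_subset)
  show "edges I \<subseteq> (\<lambda>(a, b). {a, b}) ` (students I \<times> schools I)"
    by (auto elim!: edge_obtain)
qed (simp add: finite_students finite_schools)

lemma mates_student: "a \<in> students I \<Longrightarrow> M \<subseteq> edges I \<Longrightarrow> mates M a \<subseteq> schools I"
  using edge_sides disjoint_sides by (fastforce simp: mates_def)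

lemma mates_school: "b \<in> schools I \<Longrightarrow> M \<subseteq> edges I \<Longrightarrow> mates M b \<subseteq> students I"
  using edge_sides disjoint_sides by (fastforce simp: mates_def)

lemma mates_vertices: "M \<subseteq> edges I \<Longrightarrow> w \<in> mates M v \<Longrightarrow> v \<in> vertices \<and> w \<in> vertices"
  using edge_sides by (fastforce simp: mates_def)

lemma finite_mates: "M \<subseteq> edges I \<Longrightarrow> finite (mates M v)"
  by (rule finite_subset[of _ vertices])
    (use mates_vertices in \<open>auto simp: finite_students finite_schools\<close>)

lemma less_at_linear:
  assumes "v \<in> vertices"
  shows "less_at v \<subseteq> mates (edges I) v \<times> mates (edges I) v"
    and "strict_linear_order_on (mates (edges I) v) (less_at v)"
  using inst assms unfolding stable_assignment_instance_def by blast+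

lemma less_at_trans:
  "v \<in> vertices \<Longrightarrow> (x, y) \<in> less_at v \<Longrightarrow> (y, z) \<in> less_at v \<Longrightarrow> (x, z) \<in> less_at v"
  using less_at_linear(2) unfolding strict_linear_order_on_def trans_def by blast

lemma less_at_irrefl: "v \<in> vertices \<Longrightarrow> (x, x) \<notin> less_at v"
  using less_at_linear(2) unfolding strict_linear_order_on_def irrefl_def by blast

lemma less_at_asym: "v \<in> vertices \<Longrightarrow> (x, y) \<in> less_at v \<Longrightarrow> (y, x) \<notin> less_at v"
  using less_at_trans less_at_irrefl by blast

lemma less_at_total:
  "v \<in> vertices \<Longrightarrow> x \<in> mates (edges I) v \<Longrightarrow> y \<in> mates (edges I) v \<Longrightarrow> x \<noteq> y \<Longrightarrow>
    (x, y) \<in> less_at v \<or> (y, x) \<in> less_at v"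
  using less_at_linear(2) unfolding strict_linear_order_on_def total_on_def by blast

lemma finite_less_at: "v \<in> vertices \<Longrightarrow> finite (less_at v)"
  by (rule finite_subset[OF less_at_linear(1)]) (auto simp: finite_mates)

lemma ex_greatest_at:
  assumes "v \<in> vertices" "S \<subseteq> mates (edges I) v" "S \<noteq> {}"
  shows "\<exists>y \<in> S. \<forall>y' \<in> S. y' = y \<or> (y', y) \<in> less_at v"
proof -
  have "finite S" using assms(2) finite_mates[of "edges I" v] by (auto intro: finite_subset)
  then show ?thesis using assms(3,2)
  proof (induction S rule: finite_ne_induct)
    case (insert x S)
    then obtain y where y: "y \<in> S" "\<forall>y' \<in> S. y' = y \<or> (y', y) \<in> less_at v" by auto
    have "(x, y) \<in> less_at v \<or> (y, x) \<in> less_at v"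
      using less_at_total[OF assms(1)] insert y(1) by blast
    then show ?case
      using y less_at_trans[OF assms(1)] by (metis insert_iff)
  qed auto
qed

lemma ex_least_at:
  assumes "v \<in> vertices" "S \<subseteq> mates (edges I) v" "S \<noteq> {}"
  shows "\<exists>y \<in> S. \<forall>y' \<in> S. y' = y \<or> (y, y') \<in> less_at v"
proof -
  have "finite S" using assms(2) finite_mates[of "edges I" v] by (auto intro: finite_subset)
  then show ?thesis using assms(3,2)
  proof (induction S rule: finite_ne_induct)
    case (insert x S)
    then obtain y where y: "y \<in> S" "\<forall>y' \<in> S. y' = y \<or> (y, y') \<in> less_at v" by auto
    have "(x, y) \<in> less_at v \<or> (y, x) \<in> less_at v"
      using less_at_total[OF assms(1)] insert y(1) by blast
    then show ?case
      using y less_at_trans[OF assms(1)] by (metis insert_iff)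
  qed auto
qed

lemma assignment_iff:
  "assignment I M \<longleftrightarrow> M \<subseteq> edges I \<and> (\<forall>v \<in> vertices. card (mates M v) \<le> quota I v)"
proof -
  have "card {e \<in> M. v \<in> e} = card (mates M v)" if "M \<subseteq> edges I" for v
  proof -
    have "{e \<in> M. v \<in> e} = (\<lambda>w. {v, w}) ` mates M v"
    proof (intro equalityI subsetI)
      fix e assume e: "e \<in> {e \<in> M. v \<in> e}"
      then obtain a b where "e = {a, b}" using \<open>M \<subseteq> edges I\<close> edge_obtain by blast
      then show "e \<in> (\<lambda>w. {v, w}) ` mates M v"
        using e by (auto simp: mates_def insert_commute)
    qed (auto simp: mates_def)
    moreover have "inj_on (\<lambda>w. {v, w}) (mates M v)"
      by (auto simp: inj_on_def doubleton_eq_iff)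
    ultimately show ?thesis by (simp add: card_image)
  qed
  then show ?thesis unfolding assignment_def by auto
qed

lemma assignment_edges: "assignment I M \<Longrightarrow> M \<subseteq> edges I"
  by (simp add: assignment_iff)

lemma assignment_card: "assignment I M \<Longrightarrow> v \<in> vertices \<Longrightarrow> card (mates M v) \<le> quota I v"
  by (simp add: assignment_iff)

lemma assignment_student:
  assumes "assignment I M" "a \<in> students I" "b \<in> mates M a"
  shows "mates M a = {b}"
proof -
  have "card (mates M a) \<le> 1" "finite (mates M a)"
    using assms assignment_card[OF assms(1), of a]
      by (auto simp: assignment_edges quota_student finite_mates)
  then show ?thesis
    using assms(3) card_le_Suc0_iff_eq[of "mates M a"] by auto
qed

lemma admits_student_empty: "a \<in> students I \<Longrightarrow> mates M a = {} \<Longrightarrow> admits M a b"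
  by (simp add: admits_def quota_student)

lemma admits_student_single:
  "a \<in> students I \<Longrightarrow> mates M a = {c} \<Longrightarrow> admits M a b \<longleftrightarrow> (c, b) \<in> less_at a"
  by (simp add: admits_def quota_student)

lemma not_admitsD:
  assumes "assignment I M" "v \<in> vertices" "\<not> admits M v w"
  shows "card (mates M v) = quota I v" and "w' \<in> mates M v \<Longrightarrow> (w', w) \<notin> less_at v"
    and "w' \<in> mates M v \<Longrightarrow> w \<in> mates (edges I) v \<Longrightarrow> w \<noteq> w' \<Longrightarrow> (w, w') \<in> less_at v"
proof -
  show "card (mates M v) = quota I v"
    using assms assignment_card[of M v] by (auto simp: admits_def)
  show *: "(w', w) \<notin> less_at v" if "w' \<in> mates M v" for w'
    using assms that by (auto simp: admits_def)
  show "(w, w') \<in> less_at v" if "w' \<in> mates M v" "w \<in> mates (edges I) v" "w \<noteq> w'"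
    using less_at_total[OF assms(2)] that * mates_mono[OF assignment_edges[OF assms(1)]] by blast
qed

lemma edge_blocks_iff:
  assumes "assignment I M"
  shows "edge_blocks I a b M \<longleftrightarrow> a \<in> students I \<and> b \<in> schools I \<and> {a, b} \<in> edges I - M \<and>
    admits M a b \<and> admits M b a"
proof -
  have "prefers I a (Some b) (partner M a) \<longleftrightarrow> b \<notin> mates M a \<and> admits M a b"
    if ab: "a \<in> students I" "{a, b} \<in> edges I"
  proof (cases "mates M a = {}")
    case True
    then show ?thesis
      using ab by (simp add: partner_def admits_student_empty mem_mates_iff)
  next
    case False
    then obtain c where c: "mates M a = {c}" using assignment_student assms ab by blast
    then show ?thesis
      using ab less_at_irrefl[of a] by (auto simp: partner_def admits_student_single[OF ab(1) c])
  qed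
  then show ?thesis
    unfolding edge_blocks_def by (auto simp: admits_def mem_mates_iff)
qed

lemma blocks_iff:
  assumes "assignment I M" "K \<subseteq> edges I"
  shows "blocks I K M \<longleftrightarrow> \<not> unblocked K M"
proof
  show "blocks I K M \<Longrightarrow> \<not> unblocked K M"
    using assms unfolding blocks_def unblocked_def by (auto simp: edge_blocks_iff)
  assume "\<not> unblocked K M"
  then obtain v w where vw: "{v, w} \<in> K - M" "admits M v w" "admits M w v"
    by (auto simp: unblocked_def)
  then have "edge_blocks I v w M \<or> edge_blocks I w v M"
    using edge_sides[of v w] assms by (auto simp: edge_blocks_iff insert_commute)
  moreover have "{w, v} \<in> K" using vw by (simp add: insert_commute)
  ultimately show "blocks I K M"
    using vw unfolding blocks_def by blast
qed

lemma stable_iff: "stable I M \<longleftrightarrow> assignment I M \<and> unblocked (edges I) M"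
proof -
  have "(\<exists>a b. edge_blocks I a b M) \<longleftrightarrow> blocks I (edges I) M"
    by (auto simp: blocks_def edge_blocks_def)
  then show ?thesis unfolding stable_def using blocks_iff by auto
qed

lemma unblocked_mono: "unblocked K M \<Longrightarrow> J \<subseteq> K \<Longrightarrow> unblocked J M"
  by (auto simp: unblocked_def)

lemma unblockedD: "unblocked K M \<Longrightarrow> w \<in> mates K v \<Longrightarrow> w \<notin> mates M v \<Longrightarrow> admits M v w \<Longrightarrow> \<not> admits M w v"
  by (auto simp: unblocked_def mem_mates_iff)

section \<open>Comparing two compatible assignments\<close>

text \<open>For a student this is strict preference for M over N (see
  \<open>prefers_iff_improves\<close>); going through \<open>admits\<close> makes an unassigned
  student need no separate clause.\<close>

definition improves :: "'v set set \<Rightarrow> 'v set set \<Rightarrow> 'v \<Rightarrow> bool" where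
  "improves M N a \<longleftrightarrow> (\<exists>b \<in> mates M a - mates N a. admits N a b)"

lemma improvesD:
  assumes "assignment I M" "a \<in> students I" "improves M N a" "b \<in> mates M a"
  shows "b \<notin> mates N a" "admits N a b"
  using assignment_student[OF assms(1,2,4)] assms(3) by (auto simp: improves_def)

lemma improves_cases:
  assumes "assignment I M" "assignment I N" "a \<in> students I" "mates M a \<noteq> mates N a"
  shows "improves M N a \<or> improves N M a"
proof (cases "mates M a = {} \<or> mates N a = {}")
  case True
  then show ?thesis
    using assms(3,4) admits_student_empty unfolding improves_def by auto
next
  case False
  then obtain b c where b: "mates M a = {b}" and c: "mates N a = {c}"
    using assignment_student assms(1-3) by blast
  have "b \<in> mates (edges I) a" "c \<in> mates (edges I) a"
    using b c mates_mono[OF assignment_edges[OF assms(1)], of a]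
      mates_mono[OF assignment_edges[OF assms(2)], of a]
    by auto
  then have "(b, c) \<in> less_at a \<or> (c, b) \<in> less_at a"
    using less_at_total[of a] assms(3,4) b c by auto
  then show ?thesis
    using assms(3,4) b c by (auto simp: improves_def admits_student_single)
qed

lemma improves_asym:
  assumes "assignment I M" "assignment I N" "a \<in> students I" "improves M N a"
  shows "\<not> improves N M a"
proof
  assume *: "improves N M a"
  then obtain b c where "b \<in> mates M a" "c \<in> mates N a"
    using assms(4) by (auto simp: improves_def)
  then have "mates M a = {b}" "mates N a = {c}"
    using assignment_student assms by blast+
  then show False
    using * assms(3,4) less_at_asym[of a] by (auto simp: improves_def admits_student_single)
qed

definition compatible :: "'v set set \<Rightarrow> 'v set set \<Rightarrow> bool" where
  "compatible M N \<longleftrightarrow> assignment I M \<and> assignment I N \<and> unblocked M N \<and> unblocked N M"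

lemma compatible_sym: "compatible M N \<Longrightarrow> compatible N M"
  by (simp add: compatible_def)

text \<open>The edge ab of M does not block N although a wants it, so b must refuse a: b is full in
  N with students it ranks above a.\<close>

lemma improving_student_rejected:
  assumes "compatible M N" "b \<in> schools I" "a \<in> mates M b" "improves M N a"
  shows "a \<notin> mates N b" "card (mates N b) = quota I b"
    "\<And>a'. a' \<in> mates N b \<Longrightarrow> (a, a') \<in> less_at b"
proof -
  have M: "assignment I M" and N: "assignment I N" and u: "unblocked M N"
    using assms by (auto simp: compatible_def)
  have a: "a \<in> students I" using mates_school assms M by (auto simp: assignment_iff)
  have ba: "b \<in> mates M a" using assms(3) mates_sym by metis
  note imp = improvesD[OF M a assms(4) ba]
  then show nb: "a \<notin> mates N b" using mates_sym by metis
  have "\<not> admits N b a" using unblockedD[OF u ba imp] .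
  note na = not_admitsD[OF N _ this]
  show "card (mates N b) = quota I b" using na(1) assms(2) by simp
  show "(a, a') \<in> less_at b" if "a' \<in> mates N b" for a'
    using na(3)[OF _ that] assms(2,3) mates_mono[OF assignment_edges[OF M]] that nb by auto
qed

text \<open>A single improving student a of M(b) decides the situation at b. A student of N(b) -
  M(b) who preferred N would be ranked below a by the refusal in M and above a by the refusal in N.
  So the improving students fill all of N(b) - M(b), but only a part of M(b) - N(b), and the former
  set is at least as large because b is full in N.\<close>

lemma improves_counts:
  assumes "compatible M N" "b \<in> schools I" "a \<in> mates M b" "improves M N a"
  shows "mates N b \<inter> {a. improves M N a} = mates N b - mates M b"
    and "card (mates M b \<inter> {a. improves M N a}) \<le> card (mates N b \<inter> {a. improves M N a})"
    and "card (mates M b \<inter> {a. improves M N a}) = card (mates N b \<inter> {a. improves M N a}) \<Longrightarrow>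
      mates M b - mates N b \<subseteq> {a. improves M N a} \<and> card (mates M b) = quota I b"
proof -
  let ?S = "{a. improves M N a}"
  have M: "assignment I M" and N: "assignment I N" using assms by (auto simp: compatible_def)
  have fin: "finite (mates M b)" "finite (mates N b)"
    using M N by (auto simp: assignment_iff finite_mates)
  have bv: "b \<in> vertices" using assms(2) by simp
  note rej = improving_student_rejected[OF assms]
  have stu: "a' \<in> students I" if "a' \<in> mates M b \<union> mates N b" for a'
    using mates_school[OF assms(2)] M N that by (auto simp: assignment_iff)
  have "improves M N a'" if "a' \<in> mates N b" "a' \<notin> mates M b" for a'
  proof (rule ccontr)
    assume "\<not> improves M N a'"
    moreover have "mates M a' \<noteq> mates N a'" using that mates_sym by metis
    ultimately have "improves N M a'" using improves_cases[OF M N] stu that by blast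
    then have "(a', a) \<in> less_at b"
      using improving_student_rejected(3)[OF compatible_sym[OF assms(1)] assms(2) that(1)] assms(3)
      by blast
    then show False using rej(3)[OF that(1)] less_at_asym[OF bv] by blast
  qed
  moreover have disj: "\<not> improves M N a'" if "a' \<in> mates N b" "a' \<in> mates M b" for a'
    using improvesD(1)[OF M stu[of a'], of N b] that mates_sym[of a' M b] mates_sym[of a' N b]
      by blast
  ultimately show eq: "mates N b \<inter> ?S = mates N b - mates M b" by blast
  have sub: "mates M b \<inter> ?S \<subseteq> mates M b - mates N b" using disj by blast
  have cM: "card (mates M b - mates N b) = card (mates M b) - card (mates M b \<inter> mates N b)"
    using fin by (simp add: card_Diff_subset_Int)
  have cN: "card (mates N b - mates M b) = card (mates N b) - card (mates M b \<inter> mates N b)"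
    using fin by (simp add: card_Diff_subset_Int Int_commute)
  have le: "card (mates M b) \<le> card (mates N b)"
    using rej(2) assignment_card[OF M bv] by simp
  have c1: "card (mates M b \<inter> ?S) \<le> card (mates M b - mates N b)"
    using sub fin by (simp add: card_mono)
  then show "card (mates M b \<inter> ?S) \<le> card (mates N b \<inter> ?S)"
    unfolding eq using cM cN le by linarith
  assume "card (mates M b \<inter> ?S) = card (mates N b \<inter> ?S)"
  then have e1: "card (mates M b \<inter> ?S) = card (mates M b - mates N b)"
    and e2: "card (mates M b - mates N b) = card (mates N b - mates M b)"
    using c1 cM cN le unfolding eq by linarith+
  have "mates M b \<inter> ?S = mates M b - mates N b"
    using card_subset_eq[OF _ sub e1] fin by simp
  moreover have "card (mates M b \<inter> mates N b) \<le> card (mates M b)"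
    using fin by (simp add: card_mono)
  ultimately show "mates M b - mates N b \<subseteq> ?S \<and> card (mates M b) = quota I b"
    using e2 cM cN le rej(2) by auto
qed

lemma sum_card_mates:
  assumes "assignment I M" "S \<subseteq> students I"
  shows "(\<Sum>b\<in>schools I. card (mates M b \<inter> S)) = card {a \<in> S. mates M a \<noteq> {}}"
proof -
  have "card (\<Union>b\<in>schools I. mates M b \<inter> S) = (\<Sum>b\<in>schools I. card (mates M b \<inter> S))"
  proof (rule card_UN_disjoint)
    show "\<forall>i\<in>schools I. \<forall>j\<in>schools I. i \<noteq> j \<longrightarrow> (mates M i \<inter> S) \<inter> (mates M j \<inter> S) = {}"
    proof (intro ballI impI equals0I)
      fix i j a assume "i \<noteq> j" and a: "a \<in> (mates M i \<inter> S) \<inter> (mates M j \<inter> S)"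
      then have "i \<in> mates M a" "j \<in> mates M a" "a \<in> students I"
        using assms(2) by (auto simp: mates_sym[of _ M a])
      then show False using assignment_student[OF assms(1)] \<open>i \<noteq> j\<close> by blast
    qed
  qed (auto simp: finite_schools finite_mates assignment_edges[OF assms(1)])
  moreover have "(\<Union>b\<in>schools I. mates M b \<inter> S) = {a \<in> S. mates M a \<noteq> {}}"
  proof (intro equalityI subsetI)
    fix a assume a: "a \<in> {a \<in> S. mates M a \<noteq> {}}"
    then obtain b where "b \<in> mates M a" by blast
    then have "b \<in> schools I" "a \<in> mates M b"
      using mates_student[OF _ assignment_edges[OF assms(1)], of a] a assms(2) mates_sym[of b M a]
        by auto
    then show "a \<in> (\<Union>b\<in>schools I. mates M b \<inter> S)" using a by blast
  qed (auto simp: mates_sym[of _ M])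
  ultimately show ?thesis by simp
qed

text \<open>Double counting of the students who prefer \<open>M\<close>: all of them are assigned under \<open>M\<close>, while no
  school has more of them under \<open>M\<close> than under \<open>N\<close>, so equality holds at every school.\<close>

lemma improves_matched_and_balanced:
  assumes "compatible M N"
  shows "\<And>a. a \<in> students I \<Longrightarrow> improves M N a \<Longrightarrow> mates N a \<noteq> {}"
    and "\<And>b. b \<in> schools I \<Longrightarrow>
      card (mates M b \<inter> {a. improves M N a}) = card (mates N b \<inter> {a. improves M N a})"
proof -
  have M: "assignment I M" and N: "assignment I N" using assms by (auto simp: compatible_def)
  define S where "S = {a \<in> students I. improves M N a}"
  have S: "S \<subseteq> students I" "finite S" using finite_students by (auto simp: S_def)
  have IntS: "mates K b \<inter> S = mates K b \<inter> {a. improves M N a}"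
    if "assignment I K" "b \<in> schools I" for K b
    using mates_school[OF that(2) assignment_edges[OF that(1)]] by (auto simp: S_def)
  have le: "card (mates M b \<inter> S) \<le> card (mates N b \<inter> S)" if b: "b \<in> schools I" for b
  proof (cases "mates M b \<inter> S = {}")
    case False
    then show ?thesis
      using improves_counts(2)[OF assms b] IntS[OF M b] IntS[OF N b] by auto
  qed simp
  have "{a \<in> S. mates M a \<noteq> {}} = S" by (auto simp: S_def improves_def)
  then have s1: "(\<Sum>b\<in>schools I. card (mates M b \<inter> S)) = card S"
    using sum_card_mates[OF M S(1)] by simp
  have s2: "(\<Sum>b\<in>schools I. card (mates N b \<inter> S)) = card {a \<in> S. mates N a \<noteq> {}}"
    using sum_card_mates[OF N S(1)] .
  have "card {a \<in> S. mates N a \<noteq> {}} \<le> card S"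
    using S by (simp add: card_mono)
  moreover have s3: "(\<Sum>b\<in>schools I. card (mates M b \<inter> S)) \<le> (\<Sum>b\<in>schools I. card (mates N b \<inter> S))"
    using le by (simp add: sum_mono)
  ultimately have s4: "card {a \<in> S. mates N a \<noteq> {}} = card S"
    and s5: "(\<Sum>b\<in>schools I. card (mates M b \<inter> S)) = (\<Sum>b\<in>schools I. card (mates N b \<inter> S))"
    using s1 s2 by linarith+
  have "{a \<in> S. mates N a \<noteq> {}} = S"
    using card_subset_eq[OF S(2) _ s4] by blast
  then show "mates N a \<noteq> {}" if "a \<in> students I" "improves M N a" for a
    using that by (auto simp: S_def)
  show "card (mates M b \<inter> {a. improves M N a}) = card (mates N b \<inter> {a. improves M N a})"
    if "b \<in> schools I" for b
    using sum_mono_inv[OF s5 le that finite_schools] IntS M N that by simp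
qed

text \<open>The balance of the counts turns the inclusions of \<open>improves_counts\<close> into
  equalities. The given student may sit at b in either assignment, since balance also yields an
  improving student in M(b).\<close>

lemma decomposition:
  assumes "compatible M N" "b \<in> schools I" "a \<in> mates M b \<union> mates N b" "improves M N a"
  shows "mates M b - mates N b \<subseteq> {a. improves M N a}"
    and "mates N b - mates M b \<subseteq> {a. improves M N a}"
    and "mates M b - mates N b \<noteq> {}" and "mates N b - mates M b \<noteq> {}"
    and "card (mates M b) = quota I b" and "card (mates N b) = quota I b"
    and "\<And>c d. c \<in> mates M b - mates N b \<Longrightarrow> d \<in> mates N b \<Longrightarrow> (c, d) \<in> less_at b"
proof -
  let ?S = "{a. improves M N a}"
  have M: "assignment I M" and N: "assignment I N" using assms by (auto simp: compatible_def)
  have fin: "finite (mates M b)" "finite (mates N b)"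
    using M N by (auto simp: assignment_iff finite_mates)
  note bal = improves_matched_and_balanced(2)[OF assms(1,2)]
  have "mates M b \<inter> ?S \<noteq> {}"
  proof
    assume "mates M b \<inter> ?S = {}"
    then have "mates N b \<inter> ?S = {}" using bal fin by simp
    then show False using assms(3,4) \<open>mates M b \<inter> ?S = {}\<close> by blast
  qed
  then obtain a' where a': "a' \<in> mates M b" "improves M N a'" by blast
  note cnt = improves_counts[OF assms(1,2) a'] and rej = improving_student_rejected[OF assms(1,2)]
  show sub: "mates M b - mates N b \<subseteq> ?S" using cnt(3) bal by blast
  show "mates N b - mates M b \<subseteq> ?S" using cnt(1) by blast
  show "mates M b - mates N b \<noteq> {}" using a' rej(1) by blast
  have "card (mates N b \<inter> ?S) \<noteq> 0" using bal a' fin by auto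
  then show "mates N b - mates M b \<noteq> {}" unfolding cnt(1) by (metis card.empty)
  show "card (mates M b) = quota I b" using cnt(3) bal by blast
  show "card (mates N b) = quota I b" using rej(2)[OF a'] .
  show "(c, d) \<in> less_at b" if "c \<in> mates M b - mates N b" "d \<in> mates N b" for c d
    using rej(3)[of c d] that sub by blast
qed

text \<open>The rural hospitals property. A student unassigned in one assignment cannot improve in
  the other, and by \<open>decomposition\<close> a school whose students differ is full in
  both.\<close>

lemma unfilled_mates_eq:
  assumes "compatible M N" "v \<in> vertices" "card (mates N v) < quota I v"
  shows "mates M v = mates N v"
proof (rule ccontr)
  assume ne: "mates M v \<noteq> mates N v"
  have M: "assignment I M" and N: "assignment I N" using assms by (auto simp: compatible_def)
  show False
  proof (cases "v \<in> students I")
    case True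
    then have "mates N v = {}"
      using assms(3) N by (simp add: quota_student finite_mates assignment_edges)
    then show False
      using ne improves_cases[OF M N True] improves_matched_and_balanced(1)[OF assms(1) True]
      by (auto simp: improves_def)
  next
    case False
    then have v: "v \<in> schools I" using assms(2) by simp
    obtain a where "a \<in> mates M v \<longleftrightarrow> a \<notin> mates N v" using ne by blast
    then have a: "a \<in> mates M v \<union> mates N v" "mates M a \<noteq> mates N a"
      using mates_sym[of a M v] mates_sym[of a N v] by auto
    then have "a \<in> students I"
      using mates_school[OF v] M N by (auto simp: assignment_iff)
    then have "improves M N a \<or> improves N M a" using improves_cases[OF M N] a(2) by blast
    then show False
      using decomposition(6)[OF assms(1) v a(1)] decomposition(5)[OF compatible_sym[OF assms(1)] v, of a]
        a(1) assms(3) by auto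
  qed
qed

end

text \<open>The relation D is left abstract so that \<open>dominates\<close> and its converse are
  both instances. The directed set T is kept apart from S so that it stays fixed during the
  induction on S.\<close>

lemma directed_bound:
  assumes "finite S" "S \<noteq> {}" "S \<subseteq> T"
    and trans: "\<And>M N K. D M N \<Longrightarrow> D N K \<Longrightarrow> D M K" and refl: "\<And>M. D M M"
    and up: "\<And>M N. M \<in> T \<Longrightarrow> N \<in> T \<Longrightarrow> \<exists>J \<in> T. D J M \<and> D J N"
  shows "\<exists>J \<in> T. \<forall>M \<in> S. D J M"
  using assms(1-3)
proof (induction S rule: finite_ne_induct)
  case (singleton M)
  then show ?case using refl by blast
next
  case (insert M S)
  then obtain J where J: "J \<in> T" "\<forall>M \<in> S. D J M" by blast
  obtain J' where J': "J' \<in> T" "D J' M" "D J' J" using up[of M J] insert.prems J(1) by blast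
  have "D J' K" if "K \<in> insert M S" for K
    using that J(2) J'(2) trans[OF J'(3)] by blast
  then show ?case using J'(1) by blast
qed

context sa_instance
begin

section \<open>Candidates of the rotation digraph and dominance\<close>

text \<open>The candidates for s_M(x) in the subgraph F, but with the unrestricted orders of
  \<open>I\<close>; for M inside F this agrees with the restricted instance by
  \<open>succ_candidates_restrict\<close>.\<close>

definition cand :: "'v set set \<Rightarrow> 'v set set \<Rightarrow> 'v \<Rightarrow> 'v set" where
  "cand F M x = {y \<in> mates F x - mates M x. \<exists>x' \<in> mates M y. (x', x) \<in> less_at y}"

lemma cand_mono: "F \<subseteq> F' \<Longrightarrow> cand F M x \<subseteq> cand F' M x"
  using mates_mono[of F F' x] by (auto simp: cand_def)

text \<open>The agent x loses its place at y to x', and its new mate y' in M is the candidate. If y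
  is a school, \<open>decomposition\<close> at y shows that x prefers N, and at y' that y' gave up a
  student it ranks below x. If y is a student, it prefers M, so the school x receives some y' that
  also prefers M and hence ranks x above its mate in N.\<close>

lemma displaced_has_cand:
  assumes "compatible M N" and x: "x \<in> mates N y"
    and least: "\<And>z. z \<in> mates N y \<Longrightarrow> z = x \<or> (x, z) \<in> less_at y"
    and x': "x' \<in> mates M y - mates N y" "(x, x') \<in> less_at y"
  shows "cand M N x \<noteq> {}"
proof -
  have M: "assignment I M" and N: "assignment I N" using assms by (auto simp: compatible_def)
  have yx: "y \<in> mates N x" using x mates_sym by metis
  have y: "y \<in> vertices" using mates_vertices assignment_edges N x by blast
  show ?thesis
  proof (cases "y \<in> schools I")
    case True
    then have stu: "x \<in> students I" "x' \<in> students I"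
      using mates_school M N x x'(1) by (auto simp: assignment_iff)
    have "mates M x' \<noteq> mates N x'" using x'(1) mates_sym[of x' M y] mates_sym[of x' N y] by auto
    moreover have "\<not> improves M N x'"
      using improving_student_rejected(3)[OF assms(1) True _ _ x] x' less_at_asym[OF y] by blast
    ultimately have "improves N M x'" using improves_cases[OF M N stu(2)] by blast
    note dec = decomposition[OF compatible_sym[OF assms(1)] True _ this]
    have dec7: "(c, d) \<in> less_at y" if "c \<in> mates N y - mates M y" "d \<in> mates M y" for c d
      using dec(7)[OF _ that] x'(1) by blast
    \<comment> \<open>Some z leaves y. If x stayed, y would rank z below x, but x is the least mate
      of y in N.\<close>
    have "x \<notin> mates M y"
    proof
      assume "x \<in> mates M y"
      moreover obtain z where z: "z \<in> mates N y - mates M y" using dec(3) x'(1) by blast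
      ultimately have "(z, x) \<in> less_at y" using dec7 by blast
      then show False using least[of z] z less_at_asym[OF y] less_at_irrefl[OF y] by blast
    qed
    then have imp: "improves N M x" using dec(1) x x'(1) by blast
    then obtain y' where y': "y' \<in> mates M x"
      using improves_matched_and_balanced(1)[OF compatible_sym[OF assms(1)] stu(1)] by blast
    have "y' \<in> schools I" using mates_student[OF stu(1) assignment_edges[OF M]] y' by blast
    moreover have xy': "x \<in> mates M y'" using y' mates_sym by metis
    ultimately have dec': "mates N y' - mates M y' \<noteq> {}"
        "\<And>c. c \<in> mates N y' - mates M y' \<Longrightarrow> (c, x) \<in> less_at y'"
      using decomposition(3,7)[OF compatible_sym[OF assms(1)] _ _ imp] by blast+
    have "y' \<noteq> y" using \<open>x \<notin> mates M y\<close> xy' by blast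
    then have "y' \<notin> mates N x" using assignment_student[OF N stu(1) yx] by simp
    then show ?thesis using y' dec' by (auto simp: cand_def)
  next
    case False
    then have stu: "y \<in> students I" using y by simp
    then have sch: "x \<in> schools I" using mates_student N x by (auto simp: assignment_iff)
    have "mates N y = {x}" using assignment_student[OF N stu x] .
    then have "improves M N y" using x' stu by (auto simp: improves_def admits_student_single)
    note dec = decomposition[OF assms(1) sch _ this]
    have yNx: "y \<in> mates N x" using x mates_sym by metis
    then obtain y' where y': "y' \<in> mates M x" "y' \<notin> mates N x" "improves M N y'"
      using dec(1,3) by blast
    have stu': "y' \<in> students I" using mates_school[OF sch assignment_edges[OF M]] y' by blast
    have xy': "x \<in> mates M y'" using y' mates_sym by metis
    obtain z where "z \<in> mates N y'"
      using improves_matched_and_balanced(1)[OF assms(1) stu' y'(3)] by blast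
    then have z: "mates N y' = {z}" using assignment_student[OF N stu'] by blast
    then have "(z, x) \<in> less_at y'"
      using improvesD(2)[OF M stu' y'(3) xy'] stu' by (simp add: admits_student_single)
    then show ?thesis using y' z by (auto simp: cand_def)
  qed
qed

text \<open>When a prefers N, its school b in M has given up a student of N(b) on the way from N to
  M, and it ranks that student below a.\<close>

lemma cand_of_worse_mate:
  assumes "compatible M N" "a \<in> students I" "b \<in> mates M a" "improves N M a"
  shows "b \<in> cand M N a"
proof -
  have M: "assignment I M" using assms by (auto simp: compatible_def)
  have b: "b \<in> schools I" using mates_student[OF assms(2) assignment_edges[OF M]] assms(3) by blast
  have ab: "a \<in> mates M b" using assms(3) mates_sym by metis
  note dec = decomposition[OF compatible_sym[OF assms(1)] b _ assms(4)]
  obtain z where "z \<in> mates N b - mates M b" using dec(3) ab by blast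
  moreover from this have "(z, a) \<in> less_at b" using dec(7)[OF _ _ ab] ab by blast
  moreover have "b \<notin> mates N a"
  proof
    assume "b \<in> mates N a"
    then have "b \<notin> mates M a"
      using improvesD(1)[OF _ assms(2,4)] assms(1) by (auto simp: compatible_def)
    then show False using assms(3) by blast
  qed
  ultimately show ?thesis using assms(3) by (auto simp: cand_def)
qed

lemma prefers_iff_improves:
  assumes "assignment I M" "assignment I N" "a \<in> students I"
  shows "prefers I a (partner M a) (partner N a) \<longleftrightarrow> improves M N a"
proof (cases "mates M a = {}")
  case True
  then show ?thesis by (simp add: partner_def improves_def)
next
  case False
  then obtain b where b: "mates M a = {b}" using assignment_student assms by blast
  have bE: "b \<in> mates (edges I) a"
    using b mates_mono[OF assignment_edges[OF assms(1)], of a] by blast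
  show ?thesis
  proof (cases "mates N a = {}")
    case True
    then show ?thesis
      using b bE assms(3) by (auto simp: partner_def improves_def admits_student_empty)
  next
    case False
    then obtain c where c: "mates N a = {c}" using assignment_student assms by blast
    then show ?thesis
      using b assms(3) less_at_irrefl[of a]
        by (auto simp: partner_def improves_def admits_student_single)
  qed
qed

lemma partner_eq_iff:
  assumes "assignment I M" "assignment I N" "a \<in> students I"
  shows "partner M a = partner N a \<longleftrightarrow> mates M a = mates N a"
proof
  assume eq: "partner M a = partner N a"
  have *: "mates K a = set_option (partner K a)" if K: "assignment I K" for K
  proof (cases "mates K a = {}")
    case False
    then obtain b where "mates K a = {b}" using assignment_student[OF K assms(3)] by blast
    then show ?thesis by (simp add: partner_def)
  qed (simp add: partner_def)
  show "mates M a = mates N a" using *[OF assms(1)] *[OF assms(2)] eq by simp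
qed (simp add: partner_def)

lemma dominates_iff:
  assumes "assignment I M" "assignment I N"
  shows "dominates I M N \<longleftrightarrow> (\<forall>a \<in> students I. \<not> improves N M a)"
proof -
  have "prefers_eq I a (partner M a) (partner N a) \<longleftrightarrow> \<not> improves N M a" if a: "a \<in> students I" for a
  proof (cases "mates M a = mates N a")
    case True
    then show ?thesis using partner_eq_iff[OF assms a] by (simp add: prefers_eq_def improves_def)
  next
    case False
    then show ?thesis
      unfolding prefers_eq_def prefers_iff_improves[OF assms a] partner_eq_iff[OF assms a]
      using improves_cases[OF assms a] improves_asym[OF assms a] by blast
  qed
  then show ?thesis by (simp add: dominates_def)
qed

text \<open>The case X = B. A student who preferred M would still be assigned in N, and would
  therefore be a candidate of its school in M.\<close>

lemma dominates_students_if_no_cand: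
  assumes "compatible M N" "\<And>b. b \<in> schools I \<Longrightarrow> cand M N b = {}"
  shows "dominates I N M"
proof -
  have M: "assignment I M" and N: "assignment I N" using assms by (auto simp: compatible_def)
  have "\<not> improves M N a" if a: "a \<in> students I" for a
  proof
    assume imp: "improves M N a"
    then obtain b where b: "b \<in> mates M a" "b \<notin> mates N a" "admits N a b"
      by (auto simp: improves_def)
    obtain c where "c \<in> mates N a"
      using improves_matched_and_balanced(1)[OF assms(1) a imp] by blast
    then have "mates N a = {c}" using assignment_student[OF N a] by blast
    then have "a \<in> cand M N b"
      using b a mates_sym[of a M b] mates_sym[of a N b]
        by (auto simp: cand_def admits_student_single)
    then show False
      using assms(2)[of b] mates_student[OF a assignment_edges[OF M]] b(1) by blast
  qed
  then show ?thesis using dominates_iff[OF N M] by blast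
qed

text \<open>The case X = A. A student who preferred N would be assigned in M, and its school there
  would be a candidate by \<open>cand_of_worse_mate\<close>.\<close>

lemma dominates_schools_if_no_cand:
  assumes "compatible M N" "\<And>a. a \<in> students I \<Longrightarrow> cand M N a = {}"
  shows "dominates I M N"
proof -
  have M: "assignment I M" and N: "assignment I N" using assms by (auto simp: compatible_def)
  have "\<not> improves N M a" if a: "a \<in> students I" for a
  proof
    assume imp: "improves N M a"
    then obtain b where "b \<in> mates M a"
      using improves_matched_and_balanced(1)[OF compatible_sym[OF assms(1)] a] by blast
    then show False using cand_of_worse_mate[OF assms(1) a _ imp] assms(2)[OF a] by blast
  qed
  then show ?thesis using dominates_iff[OF M N] by blast
qed

lemma dominates_antisym:
  assumes "assignment I M" "assignment I N" "dominates I M N" "dominates I N M"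
  shows "M = N"
proof -
  have *: "K \<subseteq> K'" if K: "K \<subseteq> edges I" "\<And>a. a \<in> students I \<Longrightarrow> mates K a = mates K' a" for K K'
  proof
    fix e assume e: "e \<in> K"
    then obtain a b where "e = {a, b}" "a \<in> students I" using K edge_obtain by blast
    then show "e \<in> K'" using e K(2)[of a] mem_mates_iff[of b K a] mem_mates_iff[of b K' a] by simp
  qed
  have "mates M a = mates N a" if "a \<in> students I" for a
    using assms that improves_cases[OF assms(1,2) that] by (auto simp: dominates_iff)
  then show ?thesis using *[of M N] *[of N M] assms(1,2) by (auto simp: assignment_iff)
qed

lemma dominates_trans:
  assumes "dominates I M N" "dominates I N K"
  shows "dominates I M K"
proof -
  have "prefers_eq I a p r"
    if "a \<in> students I" "prefers_eq I a p q" "prefers_eq I a q r" for a p q r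
  proof -
    have a: "a \<in> vertices" using that by simp
    show ?thesis
      using that(2,3) less_at_trans[OF a] less_at_linear(1)[OF a]
      by (cases p; cases q; cases r) (auto simp: prefers_eq_def)
  qed
  then show ?thesis using assms by (meson dominates_def)
qed

section \<open>Join and meet of compatible assignments\<close>

text \<open>For R = \<open>improves M N\<close> every student gets the better of its two mates (the
  join), for R = \<open>improves N M\<close> the worse one (the meet).\<close>

definition pick :: "('v \<Rightarrow> bool) \<Rightarrow> 'v set set \<Rightarrow> 'v set set \<Rightarrow> 'v set set" where
  "pick R M N = {{a, b} |a b. a \<in> students I \<and> b \<in> mates (if R a then M else N) a}"

text \<open>All students in the symmetric difference at a school agree on which assignment they
  prefer, so the individual choices of students leave each school with M(b) or N(b) as a
  whole.\<close>

lemma mates_pick: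
  assumes "compatible M N" "R = improves M N \<or> R = improves N M"
  shows "pick R M N \<subseteq> edges I"
    and "a \<in> students I \<Longrightarrow> mates (pick R M N) a = (if R a then mates M a else mates N a)"
    and "b \<in> schools I \<Longrightarrow> mates (pick R M N) b =
      (if \<exists>a \<in> mates M b \<union> mates N b. R a then mates M b else mates N b)"
proof -
  have M: "assignment I M" and N: "assignment I N" using assms by (auto simp: compatible_def)
  have ME: "M \<subseteq> edges I" "N \<subseteq> edges I" using M N assignment_edges by auto
  show "pick R M N \<subseteq> edges I" using ME by (auto simp: pick_def mem_mates_iff split: if_splits)
  have iff: "{a, b} \<in> pick R M N \<longleftrightarrow> b \<in> mates (if R a then M else N) a" if "a \<in> students I" for a b
  proof
    assume "{a, b} \<in> pick R M N"
    then obtain a' b' where *: "{a, b} = {a', b'}" "a' \<in> students I" "b' \<in> mates (if R a' then M else N) a'"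
      by (auto simp: pick_def)
    then have "b' \<in> schools I"
      using mates_student[OF *(2) ME(1)] mates_student[OF *(2) ME(2)] by (auto split: if_splits)
    then have "a = a'" "b = b'" using *(1,2) that disjoint_sides by (auto simp: doubleton_eq_iff)
    then show "b \<in> mates (if R a then M else N) a" using *(3) by simp
  next
    assume "b \<in> mates (if R a then M else N) a"
    then show "{a, b} \<in> pick R M N" unfolding pick_def using that by blast
  qed
  show "mates (pick R M N) a = (if R a then mates M a else mates N a)" if "a \<in> students I"
    using iff[OF that] by (auto simp: mem_mates_iff)
  assume b: "b \<in> schools I"
  have diff: "R a" if "c \<in> mates M b \<union> mates N b" "R c"
      "a \<in> mates M b \<union> mates N b" "\<not> (a \<in> mates M b \<and> a \<in> mates N b)" for a c
    using assms(2) that decomposition(1,2)[OF assms(1) b, of c]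
      decomposition(1,2)[OF compatible_sym[OF assms(1)] b, of c] by blast
  have mem: "a \<in> mates (pick R M N) b \<longleftrightarrow> a \<in> mates (if R a then M else N) b"
    if "a \<in> students I" for a
    using iff[OF that, of b] mates_sym[of a _ b] by (simp add: mem_mates_iff insert_commute)
  have stu: "mates (pick R M N) b \<subseteq> students I" "mates M b \<subseteq> students I" "mates N b \<subseteq> students I"
    using mates_school[OF b] ME \<open>pick R M N \<subseteq> edges I\<close> by blast+
  show "mates (pick R M N) b = (if \<exists>a \<in> mates M b \<union> mates N b. R a then mates M b else mates N b)"
  proof (cases "\<exists>a \<in> mates M b \<union> mates N b. R a")
    case True
    then obtain c where "c \<in> mates M b \<union> mates N b" "R c" by blast
    note d = diff[OF this]
    have "a \<in> mates (pick R M N) b \<longleftrightarrow> a \<in> mates M b" for a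
      using mem[of a] d[of a] stu by (cases "R a") auto
    then show ?thesis using True by auto
  next
    case False
    have "a \<in> mates (pick R M N) b \<longleftrightarrow> a \<in> mates N b" for a
      using mem[of a] False stu by (cases "R a") auto
    then show ?thesis using False by auto
  qed
qed

lemma admits_of_improves:
  assumes "assignment I P" "assignment I Q" "a \<in> students I" "improves P Q a" "admits P a b"
  shows "admits Q a b"
proof -
  obtain c where c: "c \<in> mates P a" "admits Q a c" using assms(4) by (auto simp: improves_def)
  then have "mates P a = {c}" using assignment_student assms by blast
  then have "(c, b) \<in> less_at a" using assms(3,5) by (simp add: admits_student_single)
  then show ?thesis using c(2) less_at_trans[of a _ c b] assms(3) by (auto simp: admits_def)
qed

text \<open>Where students prefer P, the school prefers Q; what it would accept in Q it accepts even
  more readily in P.\<close>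

lemma admits_school_of_improves:
  assumes "compatible P Q" "b \<in> schools I" "c \<in> mates P b \<union> mates Q b" "improves P Q c" "admits Q b a"
  shows "admits P b a"
proof -
  note dec = decomposition[OF assms(1-4)]
  obtain d where "d \<in> mates Q b" "(d, a) \<in> less_at b"
    using assms(5) dec(6) by (auto simp: admits_def)
  moreover obtain c' where "c' \<in> mates P b - mates Q b" using dec(3) by blast
  ultimately show ?thesis
    using dec(7)[of c' d] less_at_trans[of b c' d a] assms(2) by (auto simp: admits_def)
qed

text \<open>If both ends of a blocking edge ab took their mates from the same assignment, ab would
  block that one. Otherwise a follows P and b follows Q. If a prefers P, it also accepts b in Q, and
  ab blocks Q; if some student at b prefers P, then b also accepts a in P, and ab blocks P.\<close>

lemma unblocked_pick:
  assumes "compatible M N" "R = improves M N \<or> R = improves N M"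
    and "K \<subseteq> edges I" "unblocked K M" "unblocked K N"
  shows "assignment I (pick R M N)" and "unblocked K (pick R M N)"
proof -
  let ?J = "pick R M N"
  have M: "assignment I M" and N: "assignment I N" using assms by (auto simp: compatible_def)
  note mp = mates_pick[OF assms(1,2)]
  have "mates ?J v = mates M v \<or> mates ?J v = mates N v" if "v \<in> vertices" for v
  proof (cases "v \<in> students I")
    case True
    show ?thesis unfolding mp(2)[OF True] by simp
  next
    case False
    then have v: "v \<in> schools I" using that by simp
    show ?thesis unfolding mp(3)[OF v] by simp
  qed
  then have "card (mates ?J v) \<le> quota I v" if "v \<in> vertices" for v
    using that assignment_card[OF M that] assignment_card[OF N that] by metis
  then show "assignment I ?J" using mp(1) by (simp add: assignment_iff)
  have main: "\<not> (admits ?J a b \<and> admits ?J b a)"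
    if ab: "a \<in> students I" "b \<in> schools I" "{a, b} \<in> K - ?J" for a b
  proof
    assume adm: "admits ?J a b \<and> admits ?J b a"
    have cong: "admits ?J v w \<longleftrightarrow> admits P v w" if "mates ?J v = mates P v" for v w P
      using that by (simp add: admits_def)
    have notin: "b \<notin> mates ?J a" "a \<notin> mates ?J b"
      using ab(3) by (auto simp: mem_mates_iff insert_commute)
    have false: False if "P = M \<or> P = N" "b \<notin> mates P a" "admits P a b" "admits P b a" for P
      using that unblockedD[of K P b a] ab assms(4,5) by (auto simp: mem_mates_iff)
    have same: "\<not> (mates ?J a = mates P a \<and> mates ?J b = mates P b)" if "P = M \<or> P = N" for P
      using false[OF that] cong[of a P b] cong[of b P a] notin adm by auto
    have mixed: False if PQ: "P = M \<and> Q = N \<or> P = N \<and> Q = M"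
        and J: "mates ?J a = mates P a" "mates ?J b = mates Q b"
        and alt: "improves P Q a \<or> (\<exists>c \<in> mates P b \<union> mates Q b. improves P Q c)" for P Q
    proof -
      have c: "compatible P Q" using PQ assms(1) compatible_sym by blast
      then have PA: "assignment I P" and QA: "assignment I Q" by (auto simp: compatible_def)
      have aP: "admits P a b" and aQ: "admits Q b a" using J cong adm by auto
      have nP: "b \<notin> mates P a" and nQ: "b \<notin> mates Q a" using notin J mates_sym[of b Q a] by auto
      from alt show False
      proof
        assume "improves P Q a"
        then show False using admits_of_improves[OF PA QA ab(1) _ aP] false[of Q] nQ aQ PQ by blast
      next
        assume "\<exists>c \<in> mates P b \<union> mates Q b. improves P Q c"
        then show False
          using admits_school_of_improves[OF c ab(2) _ _ aQ] false[of P] nP aP PQ by blast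
      qed
    qed
    consider "mates ?J a = mates M a" "mates ?J b = mates N b" "R a"
        "\<forall>c \<in> mates M b \<union> mates N b. \<not> R c"
      | "mates ?J a = mates N a" "mates ?J b = mates M b" "\<not> R a"
        "\<exists>c \<in> mates M b \<union> mates N b. R c"
      using mp(2)[OF ab(1)] mp(3)[OF ab(2)] same[of M] same[of N] by (auto split: if_splits)
    then show False
    proof cases
      \<comment> \<open>For R = \<open>improves M N\<close> the student a itself prefers M. For the
        other R no student at b prefers N, so one in the symmetric difference prefers M. Either way
        \<open>mixed\<close> applies; case 2 is dual.\<close>
      case 1
      have "mates M b \<noteq> mates N b" using 1 same[of M] by auto
      then obtain c where "c \<in> mates M b \<longleftrightarrow> c \<notin> mates N b" by blast
      then have c: "c \<in> mates M b \<union> mates N b" "mates M c \<noteq> mates N c"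
        using mates_sym[of c M b] mates_sym[of c N b] by auto
      then have "c \<in> students I" using mates_school[OF ab(2)] M N by (auto simp: assignment_iff)
      then have "improves M N c \<or> improves N M c" using improves_cases[OF M N] c(2) by blast
      then show False using mixed[of M N] 1 assms(2) c(1) by blast
    next
      case 2
      have "mates M a \<noteq> mates N a" using 2 same[of M] by auto
      then have "improves M N a \<or> improves N M a" using improves_cases[OF M N ab(1)] by blast
      then show False using mixed[of N M] 2 assms(2) by blast
    qed
  qed
  show "unblocked K ?J"
    unfolding unblocked_def
  proof (intro allI impI)
    fix v w assume vw: "{v, w} \<in> K - ?J"
    then have "{w, v} \<in> K - ?J" by (simp add: insert_commute)
    then show "\<not> (admits ?J v w \<and> admits ?J w v)"
      using main[of v w] main[of w v] vw edge_sides[of v w] assms(3) by blast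
  qed
qed

lemma stable_compatible: "stable I M \<Longrightarrow> stable I N \<Longrightarrow> compatible M N"
  unfolding stable_iff compatible_def using assignment_edges unblocked_mono by blast

lemma stable_bounds:
  assumes "stable I M" "stable I N"
  shows "\<exists>J. stable I J \<and> dominates I J M \<and> dominates I J N"
    and "\<exists>J. stable I J \<and> dominates I M J \<and> dominates I N J"
proof -
  have c: "compatible M N" using assms stable_compatible by blast
  have M: "assignment I M" and N: "assignment I N" using assms by (auto simp: stable_iff)
  have J: "stable I (pick R M N)" if "R = improves M N \<or> R = improves N M" for R
    using unblocked_pick[OF c that subset_refl] assms by (auto simp: stable_iff)
  \<comment> \<open>Preference depends only on the mates of a, so it can be transferred from the
    join or meet to whichever of M and N it copies at a.\<close>
  have eq: "improves P Q a \<longleftrightarrow> improves P' Q' a"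
    if "mates P a = mates P' a" "mates Q a = mates Q' a" for P Q P' Q' a
    using that by (simp add: improves_def admits_def)
  have irr: "\<not> improves P P a" for P a by (simp add: improves_def)
  let ?J = "pick (improves M N) M N" and ?K = "pick (improves N M) M N"
  have mJ: "mates ?J a = (if improves M N a then mates M a else mates N a)"
    if "a \<in> students I" for a
    using mates_pick(2)[OF c _ that] by blast
  have mK: "mates ?K a = (if improves N M a then mates M a else mates N a)"
    if "a \<in> students I" for a
    using mates_pick(2)[OF c _ that] by blast
  have SJ: "stable I ?J" "stable I ?K" using J by blast+
  then have AJ: "assignment I ?J" "assignment I ?K" by (auto simp: stable_iff)
  have "\<not> improves M ?J a \<and> \<not> improves N ?J a" if a: "a \<in> students I" for a
    using mJ[OF a] improves_asym[OF M N a] irr eq[of M a M ?J M] eq[of M a M ?J N]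
      eq[of N a N ?J M] eq[of N a N ?J N]
    by (cases "improves M N a") auto
  then have "dominates I ?J M" "dominates I ?J N"
    by (auto simp: dominates_iff AJ M N)
  then show "\<exists>J. stable I J \<and> dominates I J M \<and> dominates I J N" using SJ by blast
  have "\<not> improves ?K M a \<and> \<not> improves ?K N a" if a: "a \<in> students I" for a
    using mK[OF a] improves_asym[OF N M a] irr eq[of ?K a M M M] eq[of ?K a M N N] eq[of ?K a N M M]
      eq[of ?K a N N N]
       improves_cases[OF M N a]
    by (cases "improves N M a") auto
  then have "dominates I M ?K" "dominates I N ?K"
    by (auto simp: dominates_iff AJ M N)
  then show "\<exists>J. stable I J \<and> dominates I M J \<and> dominates I N J" using SJ by blast
qed

lemma finite_assignments: "finite {M. assignment I M}"
  by (rule finite_subset[of _ "Pow (edges I)"]) (auto simp: assignment_iff finite_edges)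

lemma dominates_refl: "dominates I M M"
  by (simp add: dominates_def prefers_eq_def)

text \<open>The definite description is justified by the bounds of the finite set of stable
  assignments, together with antisymmetry of dominance.\<close>

lemma optimal_stable_is_stable:
  assumes "\<exists>M. stable I M"
  shows "stable I (optimal_stable I Y)"
proof -
  let ?S = "{M. stable I M}"
  have fin: "finite ?S" by (rule finite_subset[OF _ finite_assignments]) (auto simp: stable_iff)
  have ne: "?S \<noteq> {}" using assms by blast
  have "\<exists>J \<in> ?S. \<forall>M \<in> ?S. dominates I J M"
    by (rule directed_bound[OF fin ne order_refl, where D = "dominates I"])
      (use dominates_trans dominates_refl stable_bounds(1) in auto)
  moreover have "\<exists>J \<in> ?S. \<forall>M \<in> ?S. dominates I M J"
    by (rule directed_bound[OF fin ne order_refl, where D = "\<lambda>M N. dominates I N M"])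
      (use dominates_trans dominates_refl stable_bounds(2) in auto)
  ultimately have "\<exists>M. optimal_in I Y ?S M"
    by (cases Y) auto
  moreover have "M = N" if "optimal_in I Y ?S M" "optimal_in I Y ?S N" for M N
  proof -
    have "stable I M" "stable I N" "dominates I M N" "dominates I N M"
      using that by (cases Y; simp)+
    then show ?thesis using dominates_antisym[of M N] by (simp add: stable_iff)
  qed
  ultimately have "\<exists>!M. optimal_in I Y ?S M" by blast
  then have "optimal_in I Y ?S (optimal_stable I Y)" unfolding optimal_stable_def by (rule theI')
  then show ?thesis by (cases Y) auto
qed

end

section \<open>Existence of stable assignments\<close>

context sa_instance
begin

text \<open>A numerical form of the order at v, larger for better agents, that supplies the weights
  and measures below.\<close>

definition rank_at :: "'v \<Rightarrow> 'v \<Rightarrow> nat" where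
  "rank_at v w = card {z. (z, w) \<in> less_at v}"

lemma rank_at_strict_mono:
  assumes "v \<in> vertices" "(w, w') \<in> less_at v"
  shows "rank_at v w < rank_at v w'"
  unfolding rank_at_def
proof (rule psubset_card_mono)
  show "finite {z. (z, w') \<in> less_at v}"
    by (rule finite_subset[OF _ finite_imageI[OF finite_less_at[OF assms(1)], of fst]]) force
  show "{z. (z, w) \<in> less_at v} \<subset> {z. (z, w') \<in> less_at v}"
    using assms less_at_trans[OF assms(1)] less_at_irrefl[OF assms(1)] by blast
qed

text \<open>Sotomayor's argument: among the assignments in which only unassigned students take part in
  blocking pairs, one that is best for the schools is stable.\<close>

definition simple :: "'v set set \<Rightarrow> 'v set set \<Rightarrow> bool" where
  "simple F N \<longleftrightarrow> assignment I N \<and> N \<subseteq> F \<and>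
     (\<forall>a \<in> students I. \<forall>b \<in> mates F a - mates N a. admits N a b \<and> admits N b a \<longrightarrow> mates N a = {})"

text \<open>The \<open>Suc\<close> makes every occupied seat count, so that filling a free seat
  raises the weight even with a student of rank 0.\<close>

definition school_weight :: "'v set set \<Rightarrow> nat" where
  "school_weight N = (\<Sum>b\<in>schools I. \<Sum>a\<in>mates N b. Suc (rank_at b a))"

text \<open>An unassigned student a from a blocking pair goes to the best school b that admits it,
  in exchange for a worse student if b is full. Afterwards a blocks with no school because b was its
  best choice, a dismissed student is unassigned as \<open>simple\<close> demands, and no school has
  become more willing to accept anyone.\<close>

lemma simple_improvement:
  assumes F: "F \<subseteq> edges I" and N: "simple F N" and nst: "\<not> unblocked F N"
  shows "\<exists>N'. simple F N' \<and> school_weight N < school_weight N'"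
proof -
  have NA: "assignment I N" and NF: "N \<subseteq> F"
    and N_simple: "\<And>a b. a \<in> students I \<Longrightarrow> b \<in> mates F a - mates N a \<Longrightarrow> admits N a b \<Longrightarrow>
      admits N b a \<Longrightarrow> mates N a = {}"
    using N by (auto simp: simple_def)
  have NE: "N \<subseteq> edges I" using NA assignment_edges by blast
  obtain v w where vw: "{v, w} \<in> F - N" "admits N v w" "admits N w v"
    using nst by (auto simp: unblocked_def)
  have "\<exists>a b. a \<in> students I \<and> b \<in> mates F a - mates N a \<and> admits N a b \<and> admits N b a"
  proof (cases "v \<in> students I")
    case True
    then show ?thesis using vw by (intro exI[of _ v] exI[of _ w]) (auto simp: mem_mates_iff)
  next
    case False
    then have "w \<in> students I" using edge_sides[of v w] vw F by blast
    then show ?thesis using vw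
      by (intro exI[of _ w] exI[of _ v]) (auto simp: mem_mates_iff insert_commute)
  qed
  then obtain a b0 where a: "a \<in> students I"
    and b0: "b0 \<in> mates F a - mates N a" "admits N a b0" "admits N b0 a"
    by blast
  then have a0: "mates N a = {}" using N_simple by blast
  have av: "a \<in> vertices" using a by simp
  define B where "B = {b \<in> mates F a. admits N b a}"
  have B: "B \<subseteq> mates (edges I) a" "B \<noteq> {}" using mates_mono[OF F, of a] b0 by (auto simp: B_def)
  obtain b where b: "b \<in> B" "\<forall>b' \<in> B. b' = b \<or> (b', b) \<in> less_at a"
    using ex_greatest_at[OF av B] by blast
  have bF: "b \<in> mates F a" and adm: "admits N b a" using b(1) by (auto simp: B_def)
  have bS: "b \<in> schools I" using mates_student[OF a F] bF by blast
  then have bv: "b \<in> vertices" by simp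
  have fin: "finite (mates N c)" for c using finite_mates[OF NE] .
  have anb: "a \<notin> mates N c" for c using a0 mates_sym[of a N c] by blast
  \<comment> \<open>The students dismissed by b: none if b has a free seat, otherwise a single one
    ranked below a. As a set, D covers both cases uniformly.\<close>
  obtain D where D: "D \<subseteq> mates N b" "\<And>d. d \<in> D \<Longrightarrow> (d, a) \<in> less_at b"
      "card (mates N b - D) < quota I b" "D = {} \<or> (\<exists>d. D = {d}) \<and> card (mates N b) = quota I b"
  proof (cases "card (mates N b) < quota I b")
    case True
    then show ?thesis using that[of "{}"] by simp
  next
    case False
    then have full: "card (mates N b) = quota I b" using assignment_card[OF NA bv] by simp
    obtain d where d: "d \<in> mates N b" "(d, a) \<in> less_at b"
      using adm False by (auto simp: admits_def)
    have "card (mates N b - {d}) < card (mates N b)" by (rule card_Diff1_less[OF fin d(1)])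
    then show ?thesis using that[of "{d}"] d full by (simp del: card_Diff_singleton)
  qed
  define N' where "N' = (N - {{d, b} |d. d \<in> D}) \<union> {{a, b}}"
  have DS: "D \<subseteq> students I" using D(1) mates_school[OF bS NE] by blast
  have N'F: "N' \<subseteq> F" using NF bF by (auto simp: N'_def mem_mates_iff)
  then have N'E: "N' \<subseteq> edges I" using F by blast
  have m_b: "mates N' b = (mates N b - D) \<union> {a}"
    using bS DS a disjoint_sides by (auto simp: N'_def mates_def doubleton_eq_iff)
  have m_school: "mates N' c = mates N c" if "c \<in> schools I" "c \<noteq> b" for c
    using bS that DS a disjoint_sides by (auto simp: N'_def mates_def doubleton_eq_iff)
  have m_a: "mates N' a = {b}"
    using bS a a0 disjoint_sides by (auto simp: N'_def mates_def doubleton_eq_iff)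
  have m_D: "mates N' d = {}" if "d \<in> D" for d
  proof -
    have dS: "d \<in> students I" using that DS by blast
    have "b \<in> mates N d" using that D(1) mates_sym[of b N d] by blast
    then have Nd: "mates N d = {b}" using assignment_student[OF NA dS] by blast
    have "d \<noteq> a" using Nd a0 by auto
    have "w \<notin> mates N' d" for w
    proof
      assume "w \<in> mates N' d"
      then have "{d, w} \<in> N \<and> {d, w} \<notin> {{d, b} |d. d \<in> D}"
        using \<open>d \<noteq> a\<close> dS bS disjoint_sides by (auto simp: N'_def mates_def doubleton_eq_iff)
      moreover from this have "w = b" using Nd by (auto simp: mem_mates_iff[symmetric])
      ultimately show False using that by blast
    qed
    then show ?thesis by blast
  qed
  have m_student: "mates N' c = mates N c" if "c \<in> students I" "c \<noteq> a" "c \<notin> D" for c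
    using bS that DS a disjoint_sides by (auto simp: N'_def mates_def doubleton_eq_iff)
  \<comment> \<open>The change does not make b more welcoming: either it had a free seat before, or
    it stays full and whoever beats the newcomer a also beats the dismissed d.\<close>
  have adm_b: "admits N b c" if N'c: "admits N' b c" for c
  proof (cases "D = {}")
    case True
    then show ?thesis using D(3) by (simp add: admits_def)
  next
    case False
    then obtain d where d: "D = {d}" "card (mates N b) = quota I b" using D(4) by blast
    have "card (mates N' b) = quota I b"
      using card_Suc_Diff1[OF fin, of d b] d D(1) fin anb by (simp add: m_b)
    then obtain w where "w \<in> mates N' b" "(w, c) \<in> less_at b" using N'c by (auto simp: admits_def)
    then show ?thesis
      using D(2)[of d] d(1) D(1) less_at_trans[OF bv, of d a c] by (auto simp: m_b admits_def)
  qed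
  have "assignment I N'"
    unfolding assignment_iff
  proof (intro conjI ballI)
    fix v assume v: "v \<in> vertices"
    consider "v = a" | "v = b" | "v \<in> D" | "v \<in> students I" "v \<noteq> a" "v \<notin> D" | "v \<in> schools I" "v \<noteq> b"
      using v by blast
    then show "card (mates N' v) \<le> quota I v"
    proof cases
      case 2
      have "card (mates N' b) \<le> Suc (card (mates N b - D))"
        unfolding m_b using fin by (simp add: card_insert_if)
      then show ?thesis using 2 D(3) by simp
    qed (use m_a m_D m_student m_school a assignment_card[OF NA v] in \<open>auto simp: quota_student\<close>)
  qed (rule N'E)
  moreover have "mates N' c = {}"
    if c: "c \<in> students I" "e \<in> mates F c - mates N' c" "admits N' c e" "admits N' e c" for c e
  proof -
    have eS: "e \<in> schools I" using mates_student[OF c(1) F] c(2) by blast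
    have adm_e: "admits N e c"
      using adm_b[of c] m_school[OF eS] c(4) by (cases "e = b") (auto simp: admits_def)
    consider "c = a" | "c \<in> D" | "c \<noteq> a" "c \<notin> D" by blast
    then show ?thesis
    proof cases
      case 1
      have "e \<in> B" using 1 c(2) adm_e by (auto simp: B_def)
      moreover have "(b, e) \<in> less_at a" using 1 c(3) m_a a by (simp add: admits_student_single)
      ultimately show ?thesis using b(2) less_at_asym[OF av] less_at_irrefl[OF av] by metis
    next
      case 3
      note m = m_student[OF c(1) 3]
      have "admits N c e" using c(3) m by (simp add: admits_def)
      then show ?thesis using N_simple[OF c(1) _ _ adm_e] c(2) m by simp
    qed (rule m_D)
  qed
  ultimately have "simple F N'" using N'F by (auto simp: simple_def)
  moreover have "school_weight N < school_weight N'"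
    unfolding school_weight_def
  proof (rule sum_strict_mono_ex1[OF finite_schools])
    have b_less: "(\<Sum>x\<in>mates N b. Suc (rank_at b x)) < (\<Sum>x\<in>mates N' b. Suc (rank_at b x))"
    proof (cases "D = {}")
      case True
      then show ?thesis using fin anb by (simp add: m_b)
    next
      case False
      then obtain d where d: "D = {d}" using D(4) by blast
      have "d \<in> mates N b" "rank_at b d < rank_at b a"
        using d D(1) rank_at_strict_mono[OF bv D(2)[of d]] by auto
      then show ?thesis
        using fin anb sum.remove[OF fin \<open>d \<in> mates N b\<close>, of "\<lambda>x. Suc (rank_at b x)"] by (simp add: m_b d)
    qed
    then show "\<exists>b\<in>schools I. (\<Sum>a\<in>mates N b. Suc (rank_at b a)) < (\<Sum>a\<in>mates N' b. Suc (rank_at b a))"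
      using bS by blast
    show "\<forall>c\<in>schools I. (\<Sum>a\<in>mates N c. Suc (rank_at c a)) \<le> (\<Sum>a\<in>mates N' c. Suc (rank_at c a))"
    proof
      fix c assume "c \<in> schools I"
      then show "(\<Sum>a\<in>mates N c. Suc (rank_at c a)) \<le> (\<Sum>a\<in>mates N' c. Suc (rank_at c a))"
        using b_less m_school[of c] by (cases "c = b") auto
    qed
  qed
  ultimately show ?thesis by blast
qed

text \<open>F is general because \<open>covered_fixpoint\<close> starts from an assignment unblocked
  by a proper edge set, not only from a stable one.\<close>

lemma ex_unblocked:
  assumes "F \<subseteq> edges I"
  shows "\<exists>N. assignment I N \<and> N \<subseteq> F \<and> unblocked F N"
proof -
  let ?S = "{N. simple F N}"
  have fin: "finite ?S"
    by (rule finite_subset[of _ "Pow (edges I)"]) (auto simp: simple_def assignment_iff finite_edges)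
  have "simple F {}" by (simp add: simple_def assignment_iff mates_def)
  then have ne: "school_weight ` ?S \<noteq> {}" by blast
  obtain N where N: "simple F N" "school_weight N = Max (school_weight ` ?S)"
    using Max_in[OF finite_imageI[OF fin] ne] by auto
  have "\<not> school_weight N < school_weight N'" if "simple F N'" for N'
    using N(2) Max_ge[OF finite_imageI[OF fin], of "school_weight N'" school_weight] that by auto
  then have "unblocked F N" using simple_improvement[OF assms N(1)] by blast
  then show ?thesis using N(1) by (auto simp: simple_def)
qed

end

section \<open>The rotation digraph\<close>

lemma pawalk_verts_conv_heads: "pcas u p v \<Longrightarrow> pawalk_verts u p = u # map snd p"
  by (induction p arbitrary: u) auto

lemma pcas_append: "pcas u (p @ q) v \<longleftrightarrow> (\<exists>w. pcas u p w \<and> pcas w q v)"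
  by (induction p arbitrary: u) auto

text \<open>The heads of the arcs of a rotation alternate between the two sides in exactly this
  pattern.\<close>

lemma distinct_concat_pairs:
  "distinct (concat (map (\<lambda>i. [f i, g i]) [0..<n])) \<longleftrightarrow>
    inj_on f {..<n} \<and> inj_on g {..<n} \<and> f ` {..<n} \<inter> g ` {..<n} = {}"
proof (induction n)
  case (Suc n)
  have inj: "inj_on h {..<Suc n} \<longleftrightarrow> inj_on h {..<n} \<and> h n \<notin> h ` {..<n}" for h :: "nat \<Rightarrow> 'a"
    by (auto simp: lessThan_Suc)
  have "set (concat (map (\<lambda>i. [f i, g i]) [0..<n])) = f ` {..<n} \<union> g ` {..<n}" by auto
  then have "distinct (concat (map (\<lambda>i. [f i, g i]) [0..<Suc n])) \<longleftrightarrow>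
      distinct (concat (map (\<lambda>i. [f i, g i]) [0..<n])) \<and> f n \<noteq> g n \<and>
      f n \<notin> f ` {..<n} \<union> g ` {..<n} \<and> g n \<notin> f ` {..<n} \<union> g ` {..<n}"
    by simp
  moreover have "insert a F \<inter> insert b G = {} \<longleftrightarrow> F \<inter> G = {} \<and> a \<noteq> b \<and> a \<notin> G \<and> b \<notin> F"
    for a b :: 'a and F G by auto
  ultimately show ?case unfolding Suc inj lessThan_Suc image_insert by simp argo
qed simp

lemma bij_betw_Suc_mod: "bij_betw (\<lambda>i. Suc i mod n) {..<n} {..<n}"
proof -
  have "inj_on (\<lambda>i. Suc i mod n) {..<n}"
    by (auto simp: inj_on_def mod_Suc split: if_splits)
  moreover have "(\<lambda>i. Suc i mod n) ` {..<n} \<subseteq> {..<n}" by auto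
  ultimately show ?thesis using endo_inj_surj[of "{..<n}"] by (auto simp: bij_betw_def)
qed

lemma opposite_opposite [simp]: "opposite (opposite X) = X"
  by (cases X) auto

context sa_instance
begin

lemma agents_disjoint: "agents I X \<inter> agents I (opposite X) = {}"
  using disjoint_sides by (cases X) auto

lemma agents_vertices: "agents I X \<subseteq> vertices"
  by (cases X) auto

lemma vertices_agents: "vertices = agents I X \<union> agents I (opposite X)"
  by (cases X) auto

lemma finite_agents: "finite (agents I X)"
  by (cases X) (auto simp: finite_students finite_schools)

lemma mates_agents: "x \<in> agents I X \<Longrightarrow> M \<subseteq> edges I \<Longrightarrow> mates M x \<subseteq> agents I (opposite X)"
  using mates_student[of x M] mates_school[of x M] by (cases X) auto

text \<open>Together with \<open>worst\<close>, the relational form of s_M(x) and next_M(x), free of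
  definite descriptions and stated with the unrestricted orders.\<close>

definition best :: "'v set set \<Rightarrow> 'v set set \<Rightarrow> 'v \<Rightarrow> 'v \<Rightarrow> bool" where
  "best F M x y \<longleftrightarrow> y \<in> cand F M x \<and> (\<forall>y' \<in> cand F M x. y' = y \<or> (y', y) \<in> less_at x)"

definition worst :: "'v set set \<Rightarrow> 'v \<Rightarrow> 'v \<Rightarrow> bool" where
  "worst M y x \<longleftrightarrow> x \<in> mates M y \<and> (\<forall>x' \<in> mates M y. x' = x \<or> (x, x') \<in> less_at y)"

lemma best_unique:
  assumes "x \<in> vertices" "best F M x y" "best F M x y'"
  shows "y = y'"
  using assms less_at_asym[OF assms(1)] unfolding best_def by metis

lemma worst_unique:
  assumes "y \<in> vertices" "worst M y x" "worst M y x'"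
  shows "x = x'"
  using assms less_at_asym[OF assms(1)] unfolding worst_def by metis

lemma cand_vertices: "F \<subseteq> edges I \<Longrightarrow> y \<in> cand F M x \<Longrightarrow> x \<in> vertices \<and> y \<in> vertices"
  using mates_vertices[of F y x] by (auto simp: cand_def)

lemma ex_best:
  assumes "F \<subseteq> edges I" "cand F M x \<noteq> {}"
  shows "\<exists>y. best F M x y"
proof -
  have x: "x \<in> vertices" using assms cand_vertices by blast
  have sub: "cand F M x \<subseteq> mates (edges I) x"
    using mates_mono[OF assms(1), of x] by (auto simp: cand_def)
  show ?thesis using ex_greatest_at[OF x sub assms(2)] unfolding best_def by blast
qed

lemma ex_worst:
  assumes "M \<subseteq> edges I" "mates M y \<noteq> {}"
  shows "\<exists>x. worst M y x"
proof -
  have y: "y \<in> vertices" using assms mates_vertices by blast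
  show ?thesis using ex_least_at[OF y mates_mono[OF assms(1)] assms(2)] unfolding worst_def by blast
qed

section \<open>Arcs and cycles in terms of candidates\<close>

lemma restrict_simps [simp]:
  "students (restrict_edges I F) = students I" "schools (restrict_edges I F) = schools I"
  "quota (restrict_edges I F) = quota I" "edges (restrict_edges I F) = F"
  "pref_less (restrict_edges I F) v = less_at v \<inter> (mates F v \<times> mates F v)"
  by (auto simp: restrict_edges_def)

lemma agents_restrict [simp]: "agents (restrict_edges I F) X = agents I X"
  by (cases X) auto

lemma succ_candidates_restrict:
  assumes "M \<subseteq> F"
  shows "succ_candidates (restrict_edges I F) M x = cand F M x"
proof -
  have "x \<in> mates F y" if "y \<in> mates F x" for y using that mates_sym by metis
  then show ?thesis
    using mates_mono[OF assms] unfolding succ_candidates_def cand_def by fastforce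
qed

lemma rot_succ_restrict:
  assumes "F \<subseteq> edges I" "M \<subseteq> F"
  shows "rot_succ (restrict_edges I F) M x = Some y \<longleftrightarrow> best F M x y"
proof -
  have iff: "(y \<in> cand F M x \<and> (\<forall>y' \<in> cand F M x. y' = y \<or> (y', y) \<in> pref_less (restrict_edges I F) x))
      \<longleftrightarrow> best F M x y" for y
    by (auto simp: best_def cand_def)
  show ?thesis
  proof (cases "cand F M x = {}")
    case True
    then show ?thesis by (simp add: rot_succ_def succ_candidates_restrict[OF assms(2)] best_def)
  next
    case False
    then obtain z where z: "best F M x z" using ex_best assms by blast
    have x: "x \<in> vertices" using False assms(1) cand_vertices by blast
    have "(THE y. best F M x y) = z" using z best_unique[OF x] by blast
    moreover have "rot_succ (restrict_edges I F) M x = Some (THE y. best F M x y)"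
      using False unfolding rot_succ_def succ_candidates_restrict[OF assms(2)] iff by simp
    ultimately show ?thesis using z best_unique[OF x] by auto
  qed
qed

lemma rot_next_restrict:
  assumes "F \<subseteq> edges I" "M \<subseteq> F" "best F M x y"
  shows "rot_next (restrict_edges I F) M x = None \<longleftrightarrow> card (mates M y) \<noteq> quota I y"
    and "rot_next (restrict_edges I F) M x = Some z \<longleftrightarrow> card (mates M y) = quota I y \<and> worst M y z"
proof -
  have rs: "rot_succ (restrict_edges I F) M x = Some y" using rot_succ_restrict assms by blast
  have ME: "M \<subseteq> edges I" using assms by blast
  have "y \<in> vertices" using assms(3) cand_vertices[OF assms(1), of y M x] by (auto simp: best_def)
  moreover have "mates M y \<noteq> {}" using assms(3) by (auto simp: best_def cand_def)
  ultimately obtain w where w: "worst M y w" "\<And>z. worst M y z \<Longrightarrow> z = w"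
    using ex_worst[OF ME, of y] worst_unique by metis
  have eq: "(z \<in> mates M y \<and> (\<forall>z' \<in> mates M y. z' = z \<or> (z, z') \<in> pref_less (restrict_edges I F) y))
      \<longleftrightarrow> worst M y z" for z
    using mates_mono[OF assms(2), of y] by (auto simp: worst_def)
  have "rot_next (restrict_edges I F) M x =
      (if card (mates M y) = quota I y then Some (THE z. worst M y z) else None)"
    unfolding rot_next_def rs option.case eq by simp
  moreover have "(THE z. worst M y z) = w" using w by blast
  ultimately have rn: "rot_next (restrict_edges I F) M x = (if card (mates M y) = quota I y then Some w else None)"
    by simp
  then show "rot_next (restrict_edges I F) M x = None \<longleftrightarrow> card (mates M y) \<noteq> quota I y"
    by simp
  have "worst M y z \<longleftrightarrow> w = z" using w by blast
  then show "rot_next (restrict_edges I F) M x = Some z \<longleftrightarrow> card (mates M y) = quota I y \<and> worst M y z"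
    unfolding rn by simp
qed

lemma arc_from_X:
  assumes "F \<subseteq> edges I" "M \<subseteq> F" "x \<in> agents I X"
  shows "(Some x, v) \<in> parcs (rotation_digraph (restrict_edges I F) X M) \<longleftrightarrow> (\<exists>y. v = Some y \<and> best F M x y)"
proof -
  have "y \<in> agents I (opposite X)" if "x' \<in> agents I X" "best F M x' y" for x' y
    using mates_agents[OF that(1) assms(1)] that(2) by (auto simp: best_def cand_def)
  then show ?thesis
    using assms(3) agents_disjoint[of X]
      by (auto simp: rotation_digraph_def rot_succ_restrict[OF assms(1,2)])
qed

lemma arc_from_Y:
  assumes "F \<subseteq> edges I" "M \<subseteq> F" "y \<in> agents I (opposite X)"
  shows "(Some y, v) \<in> parcs (rotation_digraph (restrict_edges I F) X M) \<longleftrightarrow>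
    (\<exists>x \<in> agents I X. best F M x y) \<and>
    (case v of None \<Rightarrow> card (mates M y) \<noteq> quota I y | Some z \<Rightarrow> card (mates M y) = quota I y \<and> worst M y z)"
proof -
  have "(Some y, v) \<in> parcs (rotation_digraph (restrict_edges I F) X M) \<longleftrightarrow>
      (\<exists>x \<in> agents I X. best F M x y \<and> rot_next (restrict_edges I F) M x = v)"
    using assms(3) agents_disjoint[of X]
    by (auto simp: rotation_digraph_def rot_succ_restrict[OF assms(1,2)])
  also have "\<dots> \<longleftrightarrow> (\<exists>x \<in> agents I X. best F M x y) \<and>
    (case v of None \<Rightarrow> card (mates M y) \<noteq> quota I y | Some z \<Rightarrow> card (mates M y) = quota I y \<and> worst M y z)"
    using rot_next_restrict[OF assms(1,2)] by (cases v) auto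
  finally show ?thesis .
qed

lemma arcs_empty_iff:
  assumes "F \<subseteq> edges I" "M \<subseteq> F"
  shows "parcs (rotation_digraph (restrict_edges I F) X M) = {} \<longleftrightarrow> (\<forall>x \<in> agents I X. cand F M x = {})"
proof -
  have "parcs (rotation_digraph (restrict_edges I F) X M) = {} \<longleftrightarrow> (\<forall>x \<in> agents I X. \<forall>y. \<not> best F M x y)"
    by (auto simp: rotation_digraph_def rot_succ_restrict[OF assms])
  also have "\<dots> \<longleftrightarrow> (\<forall>x \<in> agents I X. cand F M x = {})"
    using ex_best[OF assms(1), of M] unfolding best_def by blast
  finally show ?thesis .
qed

text \<open>The cycle of \<open>is_rotation\<close> unfolded: injectivity expresses that its
  vertices are distinct, the indexed conditions are its arcs.\<close>

definition rotation :: "'v set set \<Rightarrow> side \<Rightarrow> 'v set set \<Rightarrow> ('v \<times> 'v) list \<Rightarrow> bool" where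
  "rotation F X M \<rho> \<longleftrightarrow> \<rho> \<noteq> [] \<and> set \<rho> \<subseteq> agents I (opposite X) \<times> agents I X \<and>
     inj_on (\<lambda>i. fst (\<rho> ! i)) {..<length \<rho>} \<and> inj_on (\<lambda>i. snd (\<rho> ! i)) {..<length \<rho>} \<and>
     (\<forall>i<length \<rho>. worst M (fst (\<rho> ! i)) (snd (\<rho> ! i)) \<and>
        card (mates M (fst (\<rho> ! i))) = quota I (fst (\<rho> ! i)) \<and>
        best F M (snd (\<rho> ! i)) (fst (\<rho> ! (Suc i mod length \<rho>))))"

lemma is_rotation_iff:
  assumes "F \<subseteq> edges I" "M \<subseteq> F"
  shows "is_rotation (restrict_edges I F) X M \<rho> \<longleftrightarrow> rotation F X M \<rho>"
proof (cases "\<rho> \<noteq> [] \<and> set \<rho> \<subseteq> agents I (opposite X) \<times> agents I X")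
  case False
  then show ?thesis
    by (auto simp: is_rotation_def rotation_def rotation_arcs_def pre_digraph.cycle_def)
next
  case True
  let ?r = "length \<rho>" and ?D = "rotation_digraph (restrict_edges I F) X M"
  define y where "y i = fst (\<rho> ! i)" for i
  define x where "x i = snd (\<rho> ! i)" for i
  define y' where "y' i = y (Suc i mod ?r)" for i
  have r: "?r > 0" using True by simp
  have mem: "y i \<in> agents I (opposite X)" "x i \<in> agents I X" if "i < ?r" for i
    using True nth_mem[OF that] by (auto simp: x_def y_def mem_Times_iff)
  have y'_mem: "y' i \<in> agents I (opposite X)" for i using mem(1) r by (simp add: y'_def)
  have arcs: "rotation_arcs \<rho> = concat (map (\<lambda>i. [(Some (y i), Some (x i)), (Some (x i), Some (y' i))]) [0..<?r])"
    by (simp add: rotation_arcs_def x_def y_def y'_def)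
  have ne: "rotation_arcs \<rho> \<noteq> []" using r by (auto simp: arcs)
  \<comment> \<open>The end point is taken modulo the length, so that k = length yields a closed
    walk.\<close>
  have "pcas (Some (y 0)) (concat (map (\<lambda>i. [(Some (y i), Some (x i)), (Some (x i), Some (y' i))]) [0..<k]))
      (Some (y (k mod ?r)))" if "k \<le> ?r" for k
    using that
  proof (induction k)
    case (Suc k)
    then have "k mod ?r = k" by simp
    then show ?case using Suc by (auto simp: pcas_append y'_def)
  qed (use r in simp)
  then have cas: "pcas (Some (y 0)) (rotation_arcs \<rho>) (Some (y 0))" using arcs by fastforce
  have start: "Some (y 0) \<in> pverts ?D"
    using mem(1)[OF r] agents_vertices[of "opposite X"] by (auto simp: rotation_digraph_def)
  have "pre_digraph.cycle (with_proj ?D) (rotation_arcs \<rho>) \<longleftrightarrow>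
      set (rotation_arcs \<rho>) \<subseteq> parcs ?D \<and> distinct (map snd (rotation_arcs \<rho>))"
  proof
    assume "pre_digraph.cycle (with_proj ?D) (rotation_arcs \<rho>)"
    then show "set (rotation_arcs \<rho>) \<subseteq> parcs ?D \<and> distinct (map snd (rotation_arcs \<rho>))"
      by (auto simp: pre_digraph.cycle_def pre_digraph.awalk_def cas_with_proj_eq
        awalk_verts_with_proj_eq pawalk_verts_conv_heads)
  next
    assume "set (rotation_arcs \<rho>) \<subseteq> parcs ?D \<and> distinct (map snd (rotation_arcs \<rho>))"
    then show "pre_digraph.cycle (with_proj ?D) (rotation_arcs \<rho>)"
      using cas start ne unfolding pre_digraph.cycle_def pre_digraph.awalk_def
      by (intro exI[of _ "Some (y 0)"])
        (simp add: cas_with_proj_eq awalk_verts_with_proj_eq pawalk_verts_conv_heads[OF cas])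
  qed
  moreover have "set (rotation_arcs \<rho>) \<subseteq> parcs ?D \<longleftrightarrow>
      (\<forall>i<?r. (\<exists>z \<in> agents I X. best F M z (y i)) \<and>
        worst M (y i) (x i) \<and> card (mates M (y i)) = quota I (y i) \<and> best F M (x i) (y' i))"
  proof -
    have "set (rotation_arcs \<rho>) \<subseteq> parcs ?D \<longleftrightarrow>
        (\<forall>i<?r. (Some (y i), Some (x i)) \<in> parcs ?D \<and> (Some (x i), Some (y' i)) \<in> parcs ?D)"
      unfolding arcs by fastforce
    also have "\<dots> \<longleftrightarrow> (\<forall>i<?r. (\<exists>z \<in> agents I X. best F M z (y i)) \<and>
        worst M (y i) (x i) \<and> card (mates M (y i)) = quota I (y i) \<and> best F M (x i) (y' i))"
      using arc_from_X[OF assms mem(2)] arc_from_Y[OF assms mem(1)] by auto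
    finally show ?thesis .
  qed
  moreover have "distinct (map snd (rotation_arcs \<rho>)) \<longleftrightarrow> inj_on y {..<?r} \<and> inj_on x {..<?r}"
  proof -
    have "map snd (rotation_arcs \<rho>) = concat (map (\<lambda>i. [Some (x i), Some (y' i)]) [0..<?r])"
      by (simp add: arcs map_concat comp_def)
    then have "distinct (map snd (rotation_arcs \<rho>)) \<longleftrightarrow> inj_on (\<lambda>i. Some (x i)) {..<?r} \<and>
        inj_on (\<lambda>i. Some (y' i)) {..<?r} \<and>
        (\<lambda>i. Some (x i)) ` {..<?r} \<inter> (\<lambda>i. Some (y' i)) ` {..<?r} = {}"
      by (simp add: distinct_concat_pairs)
    moreover have "(\<lambda>i. Some (x i)) ` {..<?r} \<inter> (\<lambda>i. Some (y' i)) ` {..<?r} = {}"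
    proof -
      have "x i \<noteq> y' j" if "i < ?r" for i j
        using mem(2)[OF that] y'_mem[of j] agents_disjoint[of X] by auto
      then show ?thesis by auto
    qed
    moreover have "inj_on y' {..<?r} \<longleftrightarrow> inj_on y {..<?r}"
      using comp_inj_on_iff[of "\<lambda>i. Suc i mod ?r" "{..<?r}" y] bij_betw_Suc_mod[of ?r]
      by (simp add: bij_betw_def comp_def y'_def[abs_def])
    moreover have "inj_on (\<lambda>i. Some (f i)) A \<longleftrightarrow> inj_on f A" for f :: "nat \<Rightarrow> 'v" and A
      by (simp add: inj_on_def)
    ultimately show ?thesis by metis
  qed
  \<comment> \<open>An arc out of y i presupposes an X-agent that points to y i; the predecessor of
    i on the cycle is one.\<close>
  moreover have "\<exists>z \<in> agents I X. best F M z (y i)"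
    if i: "i < ?r" "\<forall>i<?r. best F M (x i) (y' i)" for i
  proof -
    have "i \<in> (\<lambda>i. Suc i mod ?r) ` {..<?r}"
      using bij_betw_Suc_mod[of ?r] i by (simp add: bij_betw_def)
    then obtain j where "j < ?r" "i = Suc j mod ?r" by auto
    then show ?thesis using i mem(2)[of j] by (auto simp: y'_def)
  qed
  ultimately have "pre_digraph.cycle (with_proj ?D) (rotation_arcs \<rho>) \<longleftrightarrow>
      inj_on y {..<?r} \<and> inj_on x {..<?r} \<and>
      (\<forall>i<?r. worst M (y i) (x i) \<and> card (mates M (y i)) = quota I (y i) \<and> best F M (x i) (y' i))"
    by blast
  then show ?thesis
    using True
      unfolding is_rotation_def rotation_def agents_restrict y'_def y_def[abs_def] x_def[abs_def]
    by blast
qed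

text \<open>If no path of two arcs ends in a sink, then x -> next_M(x) maps the finite set of
  non-sinks in X to itself, and its iteration runs into a cycle.\<close>

lemma ex_rotation_or_removable:
  assumes F: "F \<subseteq> edges I" and M: "assignment I M" "M \<subseteq> F"
    and x0: "x0 \<in> agents I X" "cand F M x0 \<noteq> {}"
  shows "(\<exists>\<rho>. rotation F X M \<rho>) \<or>
    (\<exists>x' \<in> agents I X. \<exists>y. best F M x' y \<and>
      (card (mates M y) \<noteq> quota I y \<or> (\<exists>x. card (mates M y) = quota I y \<and> worst M y x \<and> cand F M x = {})))"
proof (rule disjCI)
  assume none: "\<not> (\<exists>x' \<in> agents I X. \<exists>y. best F M x' y \<and>
      (card (mates M y) \<noteq> quota I y \<or> (\<exists>x. card (mates M y) = quota I y \<and> worst M y x \<and> cand F M x = {})))"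
  have ME: "M \<subseteq> edges I" using M F by blast
  define S where "S = {x \<in> agents I X. cand F M x \<noteq> {}}"
  have "\<exists>y z. best F M x y \<and> y \<in> agents I (opposite X) \<and> card (mates M y) = quota I y \<and> worst M y z \<and> z \<in> S"
    if x: "x \<in> S" for x
  proof -
    have xX: "x \<in> agents I X" using x by (simp add: S_def)
    obtain y where y: "best F M x y" using ex_best[OF F] x by (auto simp: S_def)
    have yY: "y \<in> agents I (opposite X)"
      using mates_agents[OF xX F] y by (auto simp: best_def cand_def)
    have ne: "mates M y \<noteq> {}" using y by (auto simp: best_def cand_def)
    obtain z where z: "worst M y z" using ex_worst[OF ME ne] by blast
    then have "z \<in> agents I X" using mates_agents[OF yY ME] by (auto simp: worst_def)
    moreover have "cand F M z \<noteq> {}" "card (mates M y) = quota I y" using none xX y z by blast+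
    ultimately show ?thesis using y yY z unfolding S_def by blast
  qed
  then obtain sc nx where sn: "\<And>x. x \<in> S \<Longrightarrow> best F M x (sc x) \<and> sc x \<in> agents I (opposite X) \<and>
      card (mates M (sc x)) = quota I (sc x) \<and> worst M (sc x) (nx x) \<and> nx x \<in> S"
    by metis
  have iter: "(nx ^^ k) z \<in> S" if "z \<in> S" for k z by (induction k) (use that sn in auto)
  have x0S: "x0 \<in> S" using x0 by (simp add: S_def)
  have finS: "finite S" using finite_agents[of X] by (simp add: S_def)
  have "\<not> inj (\<lambda>k. (nx ^^ k) x0)"
    using finite_imageD[of "\<lambda>k. (nx ^^ k) x0" UNIV] finite_subset[of "range (\<lambda>k. (nx ^^ k) x0)" S]
      finS iter[OF x0S] infinite_UNIV_nat by blast
  then obtain i j where ij: "i < j" "(nx ^^ i) x0 = (nx ^^ j) x0"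
    unfolding inj_def by (metis linorder_neqE_nat)
  define z where "z = (nx ^^ i) x0"
  have zS: "z \<in> S" using iter[OF x0S] by (simp add: z_def)
  have "(nx ^^ (j - i)) z = z"
    using ij funpow_add[of "j - i" i nx] by (simp add: z_def)
  then have ex: "\<exists>n. 0 < n \<and> (nx ^^ n) z = z" using ij(1) by (intro exI[of _ "j - i"]) simp
  \<comment> \<open>The least period makes the agents x 0, ..., x (n - 1) distinct.\<close>
  define n where "n = (LEAST n. 0 < n \<and> (nx ^^ n) z = z)"
  have n: "0 < n" "(nx ^^ n) z = z" using LeastI_ex[OF ex] by (auto simp: n_def)
  have minimal: "(nx ^^ k) z \<noteq> z" if "0 < k" "k < n" for k
    using not_less_Least[of k "\<lambda>n. 0 < n \<and> (nx ^^ n) z = z"] that by (auto simp: n_def)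
  define x where "x k = (nx ^^ k) z" for k
  have x_add: "(nx ^^ k) (x l) = x (k + l)" for k l by (simp add: x_def funpow_add)
  have x_period: "x (k + n) = x k" for k using n(2) by (simp add: x_def funpow_add)
  have xS: "x k \<in> S" for k using iter[OF zS] by (simp add: x_def)
  have x_Suc: "nx (x k) = x (Suc k)" for k by (simp add: x_def)
  have "x k \<noteq> x l" if "k < l" "l < n" for k l
  proof
    assume "x k = x l"
    then have "(nx ^^ (n - l)) (x k) = (nx ^^ (n - l)) (x l)" by simp
    then have "x (n - l + k) = x n" using that by (simp add: x_add)
    also have "\<dots> = z" using n by (simp add: x_def)
    finally have "(nx ^^ (n - l + k)) z = z" by (simp add: x_def)
    moreover have "0 < n - l + k" "n - l + k < n" using that by linarith+
    ultimately show False using minimal[of "n - l + k"] by simp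
  qed
  then have x_inj: "inj_on x {..<n}" by (metis inj_onI lessThan_iff linorder_neqE_nat)
  \<comment> \<open>The mate y k is the successor of the agent before x k. Adding the period n keeps
    the subtraction of 1 meaningful at k = 0.\<close>
  define y where "y k = sc (x (k + n - 1))" for k
  have prev: "nx (x (k + n - 1)) = x k" for k
    using x_Suc[of "k + n - 1"] x_period[of k] n(1) by simp
  have y_worst: "worst M (y k) (x k)" for k
    using sn[OF xS[of "k + n - 1"]] prev[of k] by (simp add: y_def)
  have yY: "y k \<in> agents I (opposite X)" "card (mates M (y k)) = quota I (y k)" for k
    using sn[OF xS[of "k + n - 1"]] by (auto simp: y_def)
  have y_best: "best F M (x k) (y (Suc k mod n))" if "k < n" for k
  proof -
    have "x (Suc k mod n + n - 1) = x k"
    proof (cases "Suc k < n")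
      case True
      then show ?thesis using x_period[of k] by simp
    next
      case False
      then have "Suc k = n" using that by simp
      then show ?thesis by auto
    qed
    then show ?thesis using sn[OF xS[of k]] by (simp add: y_def)
  qed
  have y_inj: "inj_on y {..<n}"
  proof (rule inj_onI)
    fix k l assume kl: "k \<in> {..<n}" "l \<in> {..<n}" "y k = y l"
    have "y k \<in> vertices" using yY(1) agents_vertices by blast
    then have "x k = x l"
      using worst_unique[of "y k" M "x k" "x l"] y_worst[of k] y_worst[of l] kl(3) by simp
    then show "k = l" using x_inj kl by (simp add: inj_on_def)
  qed
  define \<rho> where "\<rho> = map (\<lambda>k. (y k, x k)) [0..<n]"
  have [simp]: "length \<rho> = n" and nth: "\<And>k. k < n \<Longrightarrow> \<rho> ! k = (y k, x k)" by (auto simp: \<rho>_def)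
  have "rotation F X M \<rho>"
    unfolding rotation_def
  proof (intro conjI)
    show "\<rho> \<noteq> []" using n(1) by (simp add: \<rho>_def)
    show "set \<rho> \<subseteq> agents I (opposite X) \<times> agents I X" using yY(1) xS by (auto simp: \<rho>_def S_def)
    show "inj_on (\<lambda>i. fst (\<rho> ! i)) {..<length \<rho>}" using y_inj by (simp add: inj_on_def nth)
    show "inj_on (\<lambda>i. snd (\<rho> ! i)) {..<length \<rho>}" using x_inj by (simp add: inj_on_def nth)
    show "\<forall>i<length \<rho>. worst M (fst (\<rho> ! i)) (snd (\<rho> ! i)) \<and>
        card (mates M (fst (\<rho> ! i))) = quota I (fst (\<rho> ! i)) \<and>
        best F M (snd (\<rho> ! i)) (fst (\<rho> ! (Suc i mod length \<rho>)))"
      using y_worst yY(2) y_best n(1) by (simp add: nth)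
  qed
  then show "\<exists>\<rho>. rotation F X M \<rho>" by blast
qed

end

section \<open>Eliminating a rotation\<close>

context sa_instance
begin

text \<open>Only blocking edges at which y prefers x to one of its present mates are excluded. An
  edge that y would accept merely because of a free seat is tolerated, since it gives no
  candidate.\<close>

definition weakly_stable :: "side \<Rightarrow> 'v set set \<Rightarrow> 'v set set \<Rightarrow> bool" where
  "weakly_stable X F M \<longleftrightarrow> (\<forall>x \<in> agents I X. \<forall>y \<in> cand F M x. \<not> admits M x y)"

text \<open>X-agents move down their lists in every rotation, so this total decreases
  (\<open>eliminate_potential\<close>).\<close>

definition potential :: "side \<Rightarrow> 'v set set \<Rightarrow> nat" where
  "potential X M = (\<Sum>x\<in>agents I X. \<Sum>y\<in>mates M x. rank_at x y)"

text \<open>Each agent occurs at most once in the rotation, hence exchanges at most one mate: x_i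
  gives up y_i for y_(i+1), and y_i gives up x_i for x_(i-1).\<close>

lemma eliminate_mates:
  assumes F: "F \<subseteq> edges I" and M: "M \<subseteq> F" and rot: "rotation F X M \<rho>"
  shows "eliminate M \<rho> \<subseteq> F"
    and "\<And>x. x \<in> agents I X \<Longrightarrow> mates (eliminate M \<rho>) x = mates M x \<or>
      (\<exists>y0 y1. worst M y0 x \<and> best F M x y1 \<and> mates (eliminate M \<rho>) x = insert y1 (mates M x - {y0}))"
    and "\<And>y. y \<in> agents I (opposite X) \<Longrightarrow> mates (eliminate M \<rho>) y = mates M y \<or>
      (\<exists>x0 x1. worst M y x0 \<and> card (mates M y) = quota I y \<and> best F M x1 y \<and>
        mates (eliminate M \<rho>) y = insert x1 (mates M y - {x0}))"
    and "\<exists>x \<in> agents I X. mates (eliminate M \<rho>) x \<noteq> mates M x"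
proof -
  let ?N = "eliminate M \<rho>" and ?r = "length \<rho>"
  define y where "y i = fst (\<rho> ! i)" for i
  define x where "x i = snd (\<rho> ! i)" for i
  define s where "s i = Suc i mod ?r" for i
  have r: "?r > 0" using rot by (simp add: rotation_def)
  have s_less: "s i < ?r" for i using r by (simp add: s_def)
  have s_onto: "\<exists>j<?r. i = s j" if "i < ?r" for i
  proof -
    have "i \<in> (\<lambda>i. Suc i mod ?r) ` {..<?r}"
      using bij_betw_Suc_mod[of ?r] that by (simp add: bij_betw_def)
    then show ?thesis by (auto simp: s_def)
  qed
  have s_inj: "inj_on s {..<?r}"
    using bij_betw_Suc_mod[of ?r] by (simp add: bij_betw_def s_def[abs_def])
  have mem: "y i \<in> agents I (opposite X)" "x i \<in> agents I X" if "i < ?r" for i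
  proof -
    have "\<rho> ! i \<in> agents I (opposite X) \<times> agents I X"
      using rot nth_mem[OF that] by (auto simp: rotation_def)
    then show "y i \<in> agents I (opposite X)" "x i \<in> agents I X"
      by (auto simp: x_def y_def mem_Times_iff)
  qed
  have inj: "inj_on y {..<?r}" "inj_on x {..<?r}"
    using rot by (simp_all add: rotation_def x_def[abs_def] y_def[abs_def])
  have wb: "worst M (y i) (x i)" "card (mates M (y i)) = quota I (y i)" "best F M (x i) (y (s i))"
    if "i < ?r" for i
    using rot that by (auto simp: rotation_def x_def y_def s_def)
  have N: "?N = (M - {{x i, y i} |i. i < ?r}) \<union> {{x i, y (s i)} |i. i < ?r}"
    by (simp add: eliminate_def x_def y_def s_def)
  have new: "{x i, y (s i)} \<in> F - M" if "i < ?r" for i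
    using wb(3)[OF that] by (auto simp: best_def cand_def mem_mates_iff)
  show "?N \<subseteq> F" using M new by (auto simp: N)
  have sep: "{v, w} = {x i, y j} \<longleftrightarrow> v = x i \<and> w = y j"
    if "v \<in> agents I X" "i < ?r" "j < ?r" for v w i j
    using that mem(2)[of i] mem(1)[of j] agents_disjoint[of X] by (auto simp: doubleton_eq_iff)
  have edge: "w \<in> mates ?N v \<longleftrightarrow>
      w \<in> mates M v \<and> \<not> (\<exists>i<?r. v = x i \<and> w = y i) \<or> (\<exists>i<?r. v = x i \<and> w = y (s i))"
    if "v \<in> agents I X" for v w
  proof -
    have "w \<in> mates ?N v \<longleftrightarrow> w \<in> mates M v \<and> \<not> (\<exists>i<?r. {v, w} = {x i, y i}) \<or> (\<exists>i<?r. {v, w} = {x i, y (s i)})"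
      unfolding mem_mates_iff N by blast
    then show ?thesis using sep[OF that] s_less by auto
  qed
  have ex_at: "(\<exists>k<?r. h i = h k \<and> P k) \<longleftrightarrow> P i"
    if "inj_on h {..<?r}" "i < ?r" for h :: "nat \<Rightarrow> 'v" and i P
    using inj_onD[OF that(1)] that(2) by (metis lessThan_iff)
  have at_x: "mates ?N (x i) = insert (y (s i)) (mates M (x i) - {y i})" if i: "i < ?r" for i
  proof -
    have "w \<in> mates ?N (x i) \<longleftrightarrow> w \<in> mates M (x i) \<and> w \<noteq> y i \<or> w = y (s i)" for w
      unfolding edge[OF mem(2)[OF i]] ex_at[OF inj(2) i] by simp
    then show ?thesis by blast
  qed
  show "mates ?N v = mates M v \<or>
      (\<exists>y0 y1. worst M y0 v \<and> best F M v y1 \<and> mates ?N v = insert y1 (mates M v - {y0}))"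
    if v: "v \<in> agents I X" for v
  proof (cases "\<exists>i<?r. v = x i")
    case True
    then obtain i where "i < ?r" "v = x i" by blast
    then show ?thesis using at_x wb(1,3) by blast
  next
    case False
    then show ?thesis using edge[OF v] by blast
  qed
  show "\<exists>v \<in> agents I X. mates ?N v \<noteq> mates M v"
  proof -
    have "y (s 0) \<notin> mates M (x 0)" using new[OF r] by (simp add: mem_mates_iff)
    then have "mates ?N (x 0) \<noteq> mates M (x 0)" using at_x[OF r] by blast
    then show ?thesis using mem(2)[OF r] by blast
  qed
  show "mates ?N w = mates M w \<or>
      (\<exists>x0 x1. worst M w x0 \<and> card (mates M w) = quota I w \<and> best F M x1 w \<and>
        mates ?N w = insert x1 (mates M w - {x0}))"
    if w: "w \<in> agents I (opposite X)" for w
  proof -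
    have sub: "?N \<subseteq> edges I" "M \<subseteq> edges I" using \<open>?N \<subseteq> F\<close> F M by auto
    have in_X: "v \<in> agents I X" if "v \<in> mates ?N w \<or> v \<in> mates M w" for v
      using mates_agents[OF w sub(1)] mates_agents[OF w sub(2)] that by auto
    have edge': "v \<in> mates ?N w \<longleftrightarrow>
        v \<in> mates M w \<and> \<not> (\<exists>i<?r. v = x i \<and> w = y i) \<or> (\<exists>i<?r. v = x i \<and> w = y (s i))" for v
    proof (cases "v \<in> agents I X")
      case True
      then show ?thesis using edge[of v w] mates_sym[of v _ w] by simp
    next
      case False
      then show ?thesis using in_X[of v] mem(2) by auto
    qed
    show ?thesis
    proof (cases "\<exists>i<?r. w = y i")
      case True
      then obtain i j where i: "i < ?r" "w = y i" and j: "j < ?r" "i = s j" using s_onto by blast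
      have inj_ys: "inj_on (\<lambda>k. y (s k)) {..<?r}"
        using comp_inj_on[OF s_inj inj_on_subset[OF inj(1)]] s_less by (auto simp: comp_def)
      have "(\<exists>k<?r. v = x k \<and> w = y k) \<longleftrightarrow> v = x i" for v
        using ex_at[OF inj(1) i(1), of "\<lambda>k. v = x k"] i(2) by (simp add: conj_commute)
      moreover have "(\<exists>k<?r. v = x k \<and> w = y (s k)) \<longleftrightarrow> v = x j" for v
        using ex_at[OF inj_ys j(1), of "\<lambda>k. v = x k"] i(2) j(2) by (simp add: conj_commute)
      ultimately have "mates ?N w = insert (x j) (mates M w - {x i})"
        using edge' by blast
      then show ?thesis using wb(1,2)[OF i(1)] wb(3)[OF j(1)] i(2) j(2) by blast
    next
      case False
      then show ?thesis using edge' s_less by blast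
    qed
  qed
qed

lemma eliminate_card:
  assumes F: "F \<subseteq> edges I" and M: "M \<subseteq> F" and rot: "rotation F X M \<rho>" and v: "v \<in> vertices"
  shows "card (mates (eliminate M \<rho>) v) = card (mates M v)"
proof -
  have fin: "finite (mates M v)" using finite_mates F M by blast
  have swap: "card (insert p (mates M v - {q})) = card (mates M v)"
    if "p \<notin> mates M v" "q \<in> mates M v" for p q
    using that fin card_Suc_Diff1[OF fin that(2)] by simp
  note em = eliminate_mates[OF assms(1-3)]
  have "mates (eliminate M \<rho>) v = mates M v \<or>
      (\<exists>p q. p \<notin> mates M v \<and> q \<in> mates M v \<and> mates (eliminate M \<rho>) v = insert p (mates M v - {q}))"
  proof (cases "v \<in> agents I X")
    case True
    then show ?thesis
      using em(2)[OF True] mates_sym[of v M] unfolding worst_def best_def cand_def by blast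
  next
    case False
    then have "v \<in> agents I (opposite X)" using v vertices_agents[of X] by blast
    then show ?thesis
      using em(3)[of v] mates_sym[of v M] unfolding worst_def best_def cand_def by blast
  qed
  then show ?thesis using swap by metis
qed

lemma eliminate_assignment:
  assumes "F \<subseteq> edges I" "assignment I M" "M \<subseteq> F" "rotation F X M \<rho>"
  shows "assignment I (eliminate M \<rho>)"
  using eliminate_mates(1)[OF assms(1,3,4)] eliminate_card[OF assms(1,3,4)] assms(1)
    assignment_card[OF assms(2)]
  by (auto simp: assignment_iff)

text \<open>Y-agents only become choosier, so a candidate y of x after the rotation was one before,
  and x refused it then. If x accepts it now, then only in comparison with a new mate, but that mate
  was the best candidate of x.\<close>

lemma eliminate_weakly_stable:
  assumes F: "F \<subseteq> edges I" and M: "M \<subseteq> F" and rot: "rotation F X M \<rho>"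
    and ws: "weakly_stable X F M"
  shows "weakly_stable X F (eliminate M \<rho>)"
  unfolding weakly_stable_def
proof (intro ballI notI)
  let ?N = "eliminate M \<rho>"
  note em = eliminate_mates[OF F M rot]
  fix x y assume x: "x \<in> agents I X" and y: "y \<in> cand F ?N x" and adm: "admits ?N x y"
  have xv: "x \<in> vertices" and yv: "y \<in> vertices" using cand_vertices[OF F y] by auto
  have yF: "y \<in> mates F x" and yN: "y \<notin> mates ?N x" using y by (auto simp: cand_def)
  have yY: "y \<in> agents I (opposite X)" using mates_agents[OF x F] yF by blast
  obtain w where w: "w \<in> mates ?N y" "(w, x) \<in> less_at y" using y by (auto simp: cand_def)
  \<comment> \<open>If w is new at y, then y was a candidate of w, so y had an even worse mate in
    M.\<close>
  have "\<exists>w' \<in> mates M y. (w', x) \<in> less_at y"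
  proof (cases "w \<in> mates M y")
    case False
    then obtain x0 where x0: "worst M y x0" "best F M w y" using em(3)[OF yY] w(1) by auto
    then obtain w' where w': "w' \<in> mates M y" "(w', w) \<in> less_at y"
      by (auto simp: best_def cand_def)
    then show ?thesis using less_at_trans[OF yv _ w(2)] by blast
  qed (use w in blast)
  then obtain w' where w': "w' \<in> mates M y" "(w', x) \<in> less_at y" by blast
  \<comment> \<open>The rotation takes from y only its worst mate, whereas y ranks w' below
    x.\<close>
  have "y \<notin> mates M x"
  proof
    assume "y \<in> mates M x"
    then have "worst M y x" using em(2)[OF x] yN by auto
    then have "w' = x \<or> (x, w') \<in> less_at y" using w'(1) by (auto simp: worst_def)
    then show False using w'(2) less_at_asym[OF yv] less_at_irrefl[OF yv] by metis
  qed
  then have yc: "y \<in> cand F M x" using yF w' by (auto simp: cand_def)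
  then have nadm: "\<not> admits M x y" using ws x by (auto simp: weakly_stable_def)
  \<comment> \<open>The number of mates of x is unchanged, so the new acceptance cannot stem from a
    free seat.\<close>
  obtain u where u: "u \<in> mates ?N x" "(u, y) \<in> less_at x"
    using adm nadm eliminate_card[OF F M rot xv] by (auto simp: admits_def)
  then have "u \<notin> mates M x" using nadm by (auto simp: admits_def)
  then have "best F M x u" using em(2)[OF x] u(1) by auto
  then have "y = u \<or> (y, u) \<in> less_at x" using yc by (auto simp: best_def)
  then show False using u(2) less_at_asym[OF xv] less_at_irrefl[OF xv] by metis
qed

text \<open>Weak stability handles edges whose end in Y is full. An agent of Y with a free seat is
  not touched by the rotation and, by the assumption \<open>unfilled\<close>, already has all its
  K-neighbours as mates.\<close>

lemma eliminate_unblocked: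
  assumes F: "F \<subseteq> edges I" and M: "M \<subseteq> F" and rot: "rotation F X M \<rho>"
    and ws: "weakly_stable X F M" and K: "K \<subseteq> F"
    and unfilled: "\<And>y. y \<in> agents I (opposite X) \<Longrightarrow> card (mates M y) < quota I y \<Longrightarrow> mates K y \<subseteq> mates M y"
  shows "unblocked K (eliminate M \<rho>)"
proof -
  let ?N = "eliminate M \<rho>"
  have main: "\<not> (admits ?N x y \<and> admits ?N y x)" if xy: "x \<in> agents I X" "{x, y} \<in> K - ?N" for x y
  proof
    assume adm: "admits ?N x y \<and> admits ?N y x"
    have yK: "y \<in> mates K x" "y \<notin> mates ?N x" using xy(2) by (auto simp: mem_mates_iff)
    have yF: "y \<in> mates F x" using yK mates_mono[OF K, of x] by blast
    have yY: "y \<in> agents I (opposite X)" using mates_agents[OF xy(1) F] yF by blast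
    then have yv: "y \<in> vertices" using agents_vertices by blast
    have "y \<notin> cand F ?N x"
      using eliminate_weakly_stable[OF F M rot ws] adm xy(1) by (auto simp: weakly_stable_def)
    then have "card (mates ?N y) < quota I y" using adm yF yK by (auto simp: cand_def admits_def)
    then have less: "card (mates M y) < quota I y" using eliminate_card[OF F M rot yv] by simp
    then have "mates ?N y = mates M y" using eliminate_mates(3)[OF F M rot yY] by auto
    moreover have "x \<in> mates M y" using unfilled[OF yY less] yK(1) mates_sym[of x K y] by auto
    ultimately show False using yK(2) mates_sym[of x ?N y] by simp
  qed
  show ?thesis
    unfolding unblocked_def
  proof (intro allI impI)
    fix v w assume vw: "{v, w} \<in> K - ?N"
    then have wv: "{w, v} \<in> K - ?N" by (simp add: insert_commute)
    have "{v, w} \<in> edges I" using vw K F by blast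
    then have "v \<in> agents I X \<or> w \<in> agents I X" using edge_sides[of v w] by (cases X) auto
    then show "\<not> (admits ?N v w \<and> admits ?N w v)" using main[OF _ vw] main[OF _ wv] by blast
  qed
qed

text \<open>By weak stability x ranks all its mates above its candidate y1, so replacing any of them
  by y1 lowers the rank sum of x.\<close>

lemma eliminate_potential:
  assumes F: "F \<subseteq> edges I" and M: "assignment I M" "M \<subseteq> F" and rot: "rotation F X M \<rho>"
    and ws: "weakly_stable X F M"
  shows "potential X (eliminate M \<rho>) < potential X M"
  unfolding potential_def
proof (rule sum_strict_mono_ex1[OF finite_agents])
  let ?N = "eliminate M \<rho>"
  note em = eliminate_mates[OF F M(2) rot]
  have less: "(\<Sum>y\<in>mates ?N x. rank_at x y) < (\<Sum>y\<in>mates M x. rank_at x y)"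
    if x: "x \<in> agents I X" and ne: "mates ?N x \<noteq> mates M x" for x
  proof -
    obtain y0 y1 where y: "worst M y0 x" "best F M x y1" "mates ?N x = insert y1 (mates M x - {y0})"
      using em(2)[OF x] ne by blast
    have xv: "x \<in> vertices" using x agents_vertices by blast
    have y1: "y1 \<in> cand F M x" using y(2) by (simp add: best_def)
    then have "\<not> admits M x y1" using ws x by (auto simp: weakly_stable_def)
    note na = not_admitsD(3)[OF M(1) xv this]
    have y0: "y0 \<in> mates M x" using y(1) mates_sym[of x M y0] by (simp add: worst_def)
    have "y1 \<in> mates (edges I) x" "y1 \<notin> mates M x"
      using y1 mates_mono[OF F, of x] by (auto simp: cand_def)
    then have "rank_at x y1 < rank_at x y0" using rank_at_strict_mono[OF xv na[OF y0]] y0 by blast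
    moreover have fin: "finite (mates M x)" using finite_mates assignment_edges M(1) by blast
    moreover note sum.remove[OF fin y0, of "rank_at x"]
    ultimately show ?thesis using \<open>y1 \<notin> mates M x\<close> by (simp add: y(3))
  qed
  show "\<forall>x\<in>agents I X. (\<Sum>y\<in>mates ?N x. rank_at x y) \<le> (\<Sum>y\<in>mates M x. rank_at x y)"
    using less by (metis less_imp_le order_refl)
  show "\<exists>x\<in>agents I X. (\<Sum>y\<in>mates ?N x. rank_at x y) < (\<Sum>y\<in>mates M x. rank_at x y)"
    using em(4) less by blast
qed

end

section \<open>Legal assignments\<close>

context sa_instance
begin

lemma unblocked_imp_weakly_stable:
  assumes "unblocked F M"
  shows "weakly_stable X F M"
  unfolding weakly_stable_def
proof (intro ballI)
  fix x y assume y: "y \<in> cand F M x"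
  then have "admits M y x" by (auto simp: cand_def admits_def)
  then show "\<not> admits M x y" using unblockedD[OF assms, of y x] y by (auto simp: cand_def)
qed

text \<open>The two alternatives are the two kinds of sink. If y points to the empty agent, it has a
  free seat and the same mates in M and N; if it points to x without candidates,
  \<open>displaced_has_cand\<close> forbids that M replaces x by x'.\<close>

lemma removable_not_in_compatible:
  assumes c: "compatible M N" and F: "F \<subseteq> edges I" and MF: "M \<subseteq> F" and b: "best F N x' y"
    and sink: "card (mates N y) \<noteq> quota I y \<or> (\<exists>x. worst N y x \<and> cand F N x = {})"
  shows "{x', y} \<notin> M"
proof
  assume in_M: "{x', y} \<in> M"
  have N: "assignment I N" using c by (simp add: compatible_def)
  have yc: "y \<in> cand F N x'" using b by (simp add: best_def)
  then have yv: "y \<in> vertices" using cand_vertices[OF F] by blast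
  have x'M: "x' \<in> mates M y" using in_M by (simp add: mem_mates_iff insert_commute)
  have x'N: "x' \<notin> mates N y" using yc mates_sym[of x' N y] by (simp add: cand_def)
  from sink show False
  proof
    assume "card (mates N y) \<noteq> quota I y"
    then have "card (mates N y) < quota I y" using assignment_card[OF N yv] by simp
    then show False using unfilled_mates_eq[OF c yv] x'M x'N by simp
  next
    assume "\<exists>x. worst N y x \<and> cand F N x = {}"
    then obtain x where x: "worst N y x" "cand F N x = {}" by blast
    obtain w where w: "w \<in> mates N y" "(w, x') \<in> less_at y" using yc by (auto simp: cand_def)
    have "(x, x') \<in> less_at y"
      using x(1) w less_at_trans[OF yv, of x w x'] by (auto simp: worst_def)
    then have "cand M N x \<noteq> {}"
      using displaced_has_cand[OF c, of x y x'] x(1) x'M x'N by (auto simp: worst_def)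
    then show False using x(2) cand_mono[OF MF, of N x] by blast
  qed
qed

section \<open>Legal sets as fixed points\<close>

definition covered :: "'v set set \<Rightarrow> 'v set set" where
  "covered F = \<Union>{M. assignment I M \<and> unblocked F M}"

lemma covered_antimono: "F \<subseteq> F' \<Longrightarrow> covered F' \<subseteq> covered F"
  using unblocked_mono unfolding covered_def by blast

lemma covered_edges: "covered F \<subseteq> edges I"
  using assignment_edges unfolding covered_def by blast

text \<open>Blocking happens edge by edge, so a family blocks M exactly if its union does. A legal
  set is thus recovered from its union, which is a fixed point of \<open>covered\<close>.\<close>

lemma legal_property_iff:
  "legal_property I L \<longleftrightarrow> L = {M. assignment I M \<and> unblocked (\<Union>L) M}"
proof -
  have iff: "(\<exists>M' \<in> L. blocks I M' M) \<longleftrightarrow> \<not> unblocked (\<Union>L) M"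
    if "L \<subseteq> {M. assignment I M}" "assignment I M" for M
  proof -
    have "(\<exists>M' \<in> L. blocks I M' M) \<longleftrightarrow> (\<exists>M' \<in> L. \<not> unblocked M' M)"
      using blocks_iff[OF that(2)] that(1) assignment_edges by blast
    then show ?thesis by (auto simp: unblocked_def)
  qed
  show ?thesis
  proof (cases "L \<subseteq> {M. assignment I M}")
    case True
    then have "{M. assignment I M \<and> (\<exists>M' \<in> L. blocks I M' M)} =
        {M. assignment I M \<and> \<not> unblocked (\<Union>L) M}" using iff by blast
    then show ?thesis unfolding legal_property_def using True by auto
  qed (auto simp: legal_property_def)
qed

text \<open>Every edge of Q lies in an assignment compatible with N, so no arc of the digraph of N
  in Q can be removable, and only a rotation remains.\<close>

lemma rotation_step:
  assumes PQ: "covered Q = P" "covered P = Q" "P \<subseteq> Q"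
    and N: "assignment I N" "unblocked Q N"
    and x: "x \<in> agents I X" "cand Q N x \<noteq> {}"
  shows "\<exists>\<rho>. rotation Q X N \<rho> \<and> assignment I (eliminate N \<rho>) \<and> unblocked Q (eliminate N \<rho>) \<and>
    potential X (eliminate N \<rho>) < potential X N"
proof -
  have Q: "Q \<subseteq> edges I" using PQ(2) covered_edges by blast
  have NP: "N \<subseteq> P" using N PQ(1) by (auto simp: covered_def)
  then have NQ: "N \<subseteq> Q" using PQ(3) by blast
  \<comment> \<open>M is not blocked by P, which contains N, and N is not blocked by Q, which
    contains M.\<close>
  have member: "\<exists>M. e \<in> M \<and> M \<subseteq> Q \<and> compatible M N" if e: "e \<in> Q" for e
  proof -
    obtain M where M: "e \<in> M" "assignment I M" "unblocked P M"
      using e PQ(2) by (auto simp: covered_def)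
    have "M \<subseteq> Q" using M PQ(2) by (auto simp: covered_def)
    then have "compatible M N"
      using M N NP unblocked_mono unfolding compatible_def by blast
    then show ?thesis using M(1) \<open>M \<subseteq> Q\<close> by blast
  qed
  have ws: "weakly_stable X Q N" using unblocked_imp_weakly_stable[OF N(2)] .
  have "\<not> (\<exists>x' \<in> agents I X. \<exists>y. best Q N x' y \<and>
      (card (mates N y) \<noteq> quota I y \<or> (\<exists>x. card (mates N y) = quota I y \<and> worst N y x \<and> cand Q N x = {})))"
  proof
    assume "\<exists>x' \<in> agents I X. \<exists>y. best Q N x' y \<and>
      (card (mates N y) \<noteq> quota I y \<or> (\<exists>x. card (mates N y) = quota I y \<and> worst N y x \<and> cand Q N x = {}))"
    then obtain x' y where b: "best Q N x' y"
        and sink: "card (mates N y) \<noteq> quota I y \<or> (\<exists>x. worst N y x \<and> cand Q N x = {})" by blast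
    have "{x', y} \<in> Q" using b by (auto simp: best_def cand_def mem_mates_iff)
    then obtain M where "{x', y} \<in> M" "M \<subseteq> Q" "compatible M N" using member by blast
    then show False using removable_not_in_compatible[OF _ Q _ b sink] by blast
  qed
  then obtain \<rho> where rot: "rotation Q X N \<rho>"
    using ex_rotation_or_removable[OF Q N(1) NQ x] by blast
  have "mates Q y \<subseteq> mates N y"
    if y: "y \<in> agents I (opposite X)" "card (mates N y) < quota I y" for y
  proof
    fix z assume "z \<in> mates Q y"
    then obtain M where M: "{y, z} \<in> M" "compatible M N"
      using member[of "{y, z}"] by (auto simp: mem_mates_iff)
    have "y \<in> vertices" using y(1) agents_vertices by blast
    then show "z \<in> mates N y"
      using unfilled_mates_eq[OF M(2) _ y(2)] M(1) by (simp add: mem_mates_iff[symmetric])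
  qed
  then have "unblocked Q (eliminate N \<rho>)"
    using eliminate_unblocked[OF Q NQ rot ws order_refl] by blast
  then show ?thesis
    using rot eliminate_assignment[OF Q N(1) NQ rot] eliminate_potential[OF Q N(1) NQ rot ws]
      by blast
qed

text \<open>For an edge ab of M inside Q, start at an assignment unblocked by Q that a likes at
  least as much as M, and descend by student rotations. The descent cannot pass over b, because a
  always moves to its best candidate and b is a candidate as long as a prefers its current state. So
  some such assignment contains ab.\<close>

lemma covered_fixpoint:
  assumes PQ: "covered Q = P" "covered P = Q" "P \<subseteq> Q"
  shows "P = Q"
proof (rule equalityI[OF PQ(3)], rule subsetI)
  fix e assume "e \<in> Q"
  then obtain M where M: "e \<in> M" "assignment I M" "unblocked P M"
    using PQ(2) by (auto simp: covered_def)
  obtain a b where ab: "e = {a, b}" "a \<in> students I" "b \<in> schools I"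
    using M assignment_edges edge_obtain by blast
  have bM: "b \<in> mates M a" using M(1) ab(1) by (simp add: mem_mates_iff)
  have Ma: "mates M a = {b}" using assignment_student[OF M(2) ab(2) bM] .
  have MQ: "M \<subseteq> Q" using M PQ(2) by (auto simp: covered_def)
  have Q: "Q \<subseteq> edges I" using PQ(2) covered_edges by blast
  have av: "a \<in> vertices" using ab by simp
  define S where "S N \<longleftrightarrow> assignment I N \<and> unblocked Q N" for N
  have S_sub: "N \<subseteq> P" if "S N" for N using that PQ(1) by (auto simp: covered_def S_def)
  have compat: "compatible M N" if "S N" for N
    using that M MQ S_sub[OF that] unblocked_mono unfolding compatible_def S_def by blast
  have step: "\<exists>\<rho>. rotation Q X N \<rho> \<and> S (eliminate N \<rho>) \<and> potential X (eliminate N \<rho>) < potential X N"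
    if "S N" "x \<in> agents I X" "cand Q N x \<noteq> {}" for N X x
    using rotation_step[OF PQ, of N x X] that by (auto simp: S_def)
  obtain N0 where N0: "S N0" using ex_unblocked[OF Q] by (auto simp: S_def)
  \<comment> \<open>With minimal potential on the school side no school rotation is left, so N1 is
    at least as good for students as M.\<close>
  obtain N1 where N1: "S N1" "\<And>N. S N \<Longrightarrow> potential Schools N1 \<le> potential Schools N"
    using ex_has_least_nat[of S N0 "potential Schools"] N0 by blast
  have "cand Q N1 x = {}" if "x \<in> schools I" for x
    using step[OF N1(1), of x Schools] N1(2) that by fastforce
  then have "cand M N1 x = {}" if "x \<in> schools I" for x
    using cand_mono[OF MQ, of N1 x] that by blast
  then have "dominates I N1 M" using dominates_students_if_no_cand[OF compat[OF N1(1)]] by blast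
  then have N1a: "\<not> improves M N1 a"
    using dominates_iff[of N1 M] N1(1) M(2) ab(2) by (auto simp: S_def)
  \<comment> \<open>The states in which a has not yet fallen below b; a last one is chosen by
    minimal potential on the student side.\<close>
  define R where "R N \<longleftrightarrow> S N \<and> \<not> improves M N a" for N
  have "R N1" using N1(1) N1a by (simp add: R_def)
  then obtain N where N: "R N" "\<And>N'. R N' \<Longrightarrow> potential Students N \<le> potential Students N'"
    using ex_has_least_nat[of R N1 "potential Students"] by blast
  have SN: "S N" and NA: "assignment I N" and Na: "\<not> improves M N a"
    using N(1) by (auto simp: R_def S_def)
  have "mates M a = mates N a"
  proof (rule ccontr)
    assume "mates M a \<noteq> mates N a"
    then have "improves N M a" using improves_cases[OF M(2) NA ab(2)] Na by blast
    then have "b \<in> cand M N a" using cand_of_worse_mate[OF compat[OF SN] ab(2) bM] by blast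
    then have bc: "b \<in> cand Q N a" using cand_mono[OF MQ] by blast
    then obtain \<rho> where \<rho>: "rotation Q Students N \<rho>" "S (eliminate N \<rho>)"
        "potential Students (eliminate N \<rho>) < potential Students N"
      using step[OF SN, of a Students] ab(2) by auto
    \<comment> \<open>One more rotation must take a below b, by the minimality of N.\<close>
    have "\<not> R (eliminate N \<rho>)" using N(2) \<rho>(3) by fastforce
    then have imp: "improves M (eliminate N \<rho>) a" using \<rho>(2) by (simp add: R_def)
    have NQ: "N \<subseteq> Q" using S_sub[OF SN] PQ(3) by blast
    have "mates (eliminate N \<rho>) a \<noteq> mates N a"
      using imp Na by (auto simp: improves_def admits_def)
    then obtain y1 where y1: "best Q N a y1" "y1 \<in> mates (eliminate N \<rho>) a"
      using eliminate_mates(2)[OF Q NQ \<rho>(1), of a] ab(2) by auto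
    have "assignment I (eliminate N \<rho>)" using \<rho>(2) by (simp add: S_def)
    then have "mates (eliminate N \<rho>) a = {y1}" using assignment_student[OF _ ab(2) y1(2)] by blast
    then have "(y1, b) \<in> less_at a"
      using imp Ma ab(2) by (auto simp: improves_def admits_student_single)
    moreover have "b = y1 \<or> (b, y1) \<in> less_at a" using y1(1) bc by (auto simp: best_def)
    ultimately show False using less_at_asym[OF av] less_at_irrefl[OF av] by metis
  qed
  then have "e \<in> N" using bM ab(1) by (simp add: mem_mates_iff)
  then show "e \<in> P" using S_sub[OF SN] by blast
qed

text \<open>If P is the least fixed point of the square of \<open>covered\<close>, then
  \<open>covered P\<close> is a fixed point of the square too and contains P, so the two coincide.
  Any fixed point of \<open>covered\<close> contains P and, by antitonicity, is contained in
  \<open>covered P\<close> = P.\<close>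

lemma ex1_legal_property: "\<exists>!L. legal_property I L"
proof -
  define P where "P = lfp (\<lambda>F. covered (covered F))"
  have mono: "mono (\<lambda>F. covered (covered F))" by (simp add: monoI covered_antimono)
  have P: "covered (covered P) = P" using lfp_unfold[OF mono] by (simp add: P_def)
  have least: "P \<subseteq> F" if "covered (covered F) = F" for F
    using lfp_lowerbound[of "\<lambda>F. covered (covered F)" F] that by (simp add: P_def)
  have "P \<subseteq> covered P" using least[of "covered P"] P by simp
  then have fix_P: "covered P = P" using covered_fixpoint[OF P refl] by simp
  have unique: "F = P" if "covered F = F" for F
  proof -
    have "P \<subseteq> F" using least[of F] that by simp
    then show ?thesis using covered_antimono[of P F] that fix_P by blast
  qed
  let ?L = "{M. assignment I M \<and> unblocked P M}"
  have "\<Union>?L = P" using fix_P by (simp add: covered_def)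
  then have "legal_property I ?L" unfolding legal_property_iff by simp
  moreover have "L = ?L" if "legal_property I L" for L
  proof -
    have L: "L = {M. assignment I M \<and> unblocked (\<Union>L) M}" using that unfolding legal_property_iff .
    then have "covered (\<Union>L) = \<Union>L" unfolding covered_def by simp
    then show ?thesis using unique[of "\<Union>L"] L by simp
  qed
  ultimately show ?thesis by blast
qed

section \<open>The legal assignments and the runs of the algorithm\<close>

lemma legal_assignments_eq:
  "legal_assignments I = {M. assignment I M \<and> unblocked (\<Union>(legal_assignments I)) M}"
proof -
  have "legal_property I (legal_assignments I)"
    unfolding legal_assignments_def by (rule theI'[OF ex1_legal_property])
  then show ?thesis unfolding legal_property_iff .
qed

lemma legalI: "assignment I M \<Longrightarrow> unblocked (\<Union>(legal_assignments I)) M \<Longrightarrow> M \<in> legal_assignments I"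
  by (subst legal_assignments_eq) simp

lemma legalD:
  "M \<in> legal_assignments I \<Longrightarrow> assignment I M"
  "M \<in> legal_assignments I \<Longrightarrow> unblocked (\<Union>(legal_assignments I)) M"
  by (subst (asm) legal_assignments_eq, simp)+

lemma legal_compatible:
  assumes "M \<in> legal_assignments I" "N \<in> legal_assignments I"
  shows "compatible M N"
  unfolding compatible_def
  using legalD(1)[OF assms(1)] legalD(1)[OF assms(2)]
    unblocked_mono[OF legalD(2)[OF assms(1)] Union_upper[OF assms(2)]]
    unblocked_mono[OF legalD(2)[OF assms(2)] Union_upper[OF assms(1)]] by blast

text \<open>The current assignment stays legal, but it need not be stable in the current graph: the arcs
  ignore the edges at which a school with free seats would only accept a student as an addition.
  Such edges are not legal, and \<open>weakly_stable\<close> is what survives.\<close>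

definition invariant :: "side \<Rightarrow> 'v rr_state \<Rightarrow> bool" where
  "invariant X \<sigma> \<longleftrightarrow> fst \<sigma> \<in> legal_assignments I \<and> \<Union>(legal_assignments I) \<subseteq> snd \<sigma> \<and>
     snd \<sigma> \<subseteq> edges I \<and> weakly_stable X (snd \<sigma>) (fst \<sigma>)"

text \<open>A removal lowers the first summand, a rotation the second, and neither affects the other
  one.\<close>

definition rr_measure :: "side \<Rightarrow> 'v rr_state \<Rightarrow> nat" where
  "rr_measure X \<sigma> = card (snd \<sigma>) + potential X (fst \<sigma>)"

lemma rr_digraph_eq: "rr_digraph I X (M, F) = rotation_digraph (restrict_edges I F) X M"
  by (simp add: rr_digraph_def)

lemma sink_iff:
  assumes "F \<subseteq> edges I" "M \<subseteq> F" "x \<in> agents I X"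
  shows "is_sink (rr_digraph I X (M, F)) (Some x) \<longleftrightarrow> cand F M x = {}"
proof -
  have "Some x \<in> pverts (rr_digraph I X (M, F))"
    using assms(3) agents_vertices[of X] by (auto simp: rr_digraph_eq rotation_digraph_def)
  then have "is_sink (rr_digraph I X (M, F)) (Some x) \<longleftrightarrow>
      (\<forall>v. (Some x, v) \<notin> parcs (rotation_digraph (restrict_edges I F) X M))"
    by (auto simp: is_sink_def out_arcs_def rr_digraph_eq)
  also have "\<dots> \<longleftrightarrow> cand F M x = {}"
    using ex_best[OF assms(1), of M x] unfolding arc_from_X[OF assms] best_def by blast
  finally show ?thesis .
qed

lemma invariant_init: "invariant X (rr_init I X)"
proof -
  let ?M = "optimal_stable I (opposite X)"
  have "\<exists>M. stable I M" using ex_unblocked[of "edges I"] by (auto simp: stable_iff)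
  then have "stable I ?M" by (rule optimal_stable_is_stable)
  then have M: "assignment I ?M" "unblocked (edges I) ?M" by (auto simp: stable_iff)
  have "\<Union>(legal_assignments I) \<subseteq> edges I" using legalD(1) assignment_edges by blast
  moreover from this have "?M \<in> legal_assignments I"
    using legalI[OF M(1)] unblocked_mono[OF M(2)] by blast
  ultimately show ?thesis
    using unblocked_imp_weakly_stable[OF M(2)] by (simp add: invariant_def rr_init_def)
qed

text \<open>A removed edge is in no assignment compatible with M, hence in no legal one. After a
  rotation the assignment is still unblocked by the union of the legal ones, where
  \<open>unfilled_mates_eq\<close> takes care of agents with free seats.\<close>

lemma invariant_step:
  assumes "rr_step I X \<sigma> \<sigma>'" "invariant X \<sigma>"
  shows "invariant X \<sigma>' \<and> rr_measure X \<sigma>' < rr_measure X \<sigma>"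
  using assms
proof cases
  case (remove x' y M F x)
  let ?P = "\<Union>(legal_assignments I)"
  have inv: "M \<in> legal_assignments I" "?P \<subseteq> F" "F \<subseteq> edges I" "weakly_stable X F M"
    using assms(2) remove(1) by (auto simp: invariant_def)
  then have MF: "M \<subseteq> F" by blast
  have b: "best F M x' y"
    using remove(4) arc_from_X[OF inv(3) MF remove(3)] by (simp add: rr_digraph_eq)
  then have yF: "{x', y} \<in> F" by (auto simp: best_def cand_def mem_mates_iff)
  then have yY: "y \<in> agents I (opposite X)"
    using mates_agents[OF remove(3) inv(3)] by (auto simp: mem_mates_iff)
  have arc: "case x of None \<Rightarrow> card (mates M y) \<noteq> quota I y
      | Some z \<Rightarrow> card (mates M y) = quota I y \<and> worst M y z"
    using remove(5) arc_from_Y[OF inv(3) MF yY] by (simp add: rr_digraph_eq)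
  have sink: "card (mates M y) \<noteq> quota I y \<or> (\<exists>x. worst M y x \<and> cand F M x = {})"
  proof (cases x)
    case None
    then show ?thesis using arc by simp
  next
    case (Some z)
    then have z: "worst M y z" using arc by simp
    then have "z \<in> agents I X"
      using mates_agents[OF yY, of M] MF inv(3) by (auto simp: worst_def)
    then have "cand F M z = {}" using sink_iff[OF inv(3) MF] remove(6) Some by blast
    then show ?thesis using z by blast
  qed
  have "{x', y} \<notin> M'" if "M' \<in> legal_assignments I" for M'
    using removable_not_in_compatible[OF legal_compatible[OF that inv(1)] inv(3) _ b sink] that
      inv(2) by blast
  then have "?P \<subseteq> F - {{x', y}}" using inv(2) by blast
  moreover have "weakly_stable X (F - {{x', y}}) M"
    using inv(4) cand_mono[of "F - {{x', y}}" F M] unfolding weakly_stable_def by blast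
  moreover have "card (F - {{x', y}}) < card F"
    using yF finite_subset[OF inv(3) finite_edges] by (rule card_Diff1_less[rotated])
  ultimately show ?thesis
    using inv remove(1,2) by (auto simp: invariant_def rr_measure_def)
next
  case (rotate F M \<rho>)
  let ?P = "\<Union>(legal_assignments I)"
  have inv: "M \<in> legal_assignments I" "?P \<subseteq> F" "F \<subseteq> edges I" "weakly_stable X F M"
    using assms(2) rotate(1) by (auto simp: invariant_def)
  then have MF: "M \<subseteq> F" by blast
  have M: "assignment I M" using legalD inv(1) by blast
  have rot: "rotation F X M \<rho>" using rotate(3) is_rotation_iff[OF inv(3) MF] by blast
  have "mates ?P y \<subseteq> mates M y"
    if y: "y \<in> agents I (opposite X)" "card (mates M y) < quota I y" for y
  proof
    fix z assume "z \<in> mates ?P y"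
    then obtain M' where M': "M' \<in> legal_assignments I" "z \<in> mates M' y"
      by (auto simp: mem_mates_iff)
    have "y \<in> vertices" using y(1) agents_vertices by blast
    then show "z \<in> mates M y"
      using unfilled_mates_eq[OF legal_compatible[OF M'(1) inv(1)] _ y(2)] M'(2) by simp
  qed
  then have "unblocked ?P (eliminate M \<rho>)"
    using eliminate_unblocked[OF inv(3) MF rot inv(4,2)] by blast
  then have "eliminate M \<rho> \<in> legal_assignments I"
    using legalI eliminate_assignment[OF inv(3) M MF rot] by blast
  then show ?thesis
    using inv eliminate_weakly_stable[OF inv(3) MF rot inv(4)] rotate(1,2)
      eliminate_potential[OF inv(3) M MF rot inv(4)]
    by (auto simp: invariant_def rr_measure_def)
qed

lemma invariant_reachable: "rr_reachable I X \<sigma> \<Longrightarrow> invariant X \<sigma>"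
  unfolding rr_reachable_def
proof (induction rule: rtranclp_induct)
  case (step \<sigma> \<sigma>')
  then show ?case using invariant_step[OF step(2)] by blast
qed (rule invariant_init)

lemma no_infinite_run:
  assumes "S 0 = rr_init I X" "\<And>i::nat. rr_step I X (S i) (S (Suc i))"
  shows False
proof -
  have inv: "invariant X (S i)" for i
  proof (induction i)
    case (Suc i)
    then show ?case using invariant_step[OF assms(2)[of i]] by blast
  qed (use assms(1) invariant_init in simp)
  have "rr_measure X (S i) + i \<le> rr_measure X (S 0)" for i
  proof (induction i)
    case (Suc i)
    then show ?case using invariant_step[OF assms(2)[of i] inv[of i]] by simp
  qed simp
  from this[of "Suc (rr_measure X (S 0))"] show False by simp
qed

lemma ex_step:
  assumes "invariant X \<sigma>" "\<not> rr_halted I X \<sigma>"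
  shows "\<exists>\<sigma>'. rr_step I X \<sigma> \<sigma>'"
proof -
  obtain M F where \<sigma>: "\<sigma> = (M, F)" by (cases \<sigma>)
  have inv: "M \<in> legal_assignments I" "\<Union>(legal_assignments I) \<subseteq> F" "F \<subseteq> edges I"
    using assms(1) \<sigma> by (auto simp: invariant_def)
  then have MF: "M \<subseteq> F" by blast
  have M: "assignment I M" using legalD inv(1) by blast
  obtain x0 where x0: "x0 \<in> agents I X" "cand F M x0 \<noteq> {}"
    using assms(2) arcs_empty_iff[OF inv(3) MF] by (auto simp: rr_halted_def \<sigma> rr_digraph_eq)
  from ex_rotation_or_removable[OF inv(3) M MF x0] show ?thesis
  proof
    assume "\<exists>\<rho>. rotation F X M \<rho>"
    then show ?thesis using is_rotation_iff[OF inv(3) MF] rr_step.rotate[of I F X M] \<sigma> by blast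
  next
    assume "\<exists>x' \<in> agents I X. \<exists>y. best F M x' y \<and>
      (card (mates M y) \<noteq> quota I y \<or> (\<exists>x. card (mates M y) = quota I y \<and> worst M y x \<and> cand F M x = {}))"
    then obtain x' y where x': "x' \<in> agents I X" and b: "best F M x' y"
      and alt: "card (mates M y) \<noteq> quota I y \<or> (\<exists>x. card (mates M y) = quota I y \<and> worst M y x \<and> cand F M x = {})"
      by blast
    have yY: "y \<in> agents I (opposite X)"
      using mates_agents[OF x' inv(3)] b by (auto simp: best_def cand_def)
    have "\<exists>v. (Some y, v) \<in> parcs (rr_digraph I X (M, F)) \<and> is_sink (rr_digraph I X (M, F)) v"
      using alt
    proof
      assume "card (mates M y) \<noteq> quota I y"
      then have "(Some y, None) \<in> parcs (rr_digraph I X (M, F))"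
        using arc_from_Y[OF inv(3) MF yY] x' b by (auto simp: rr_digraph_eq)
      moreover have "is_sink (rr_digraph I X (M, F)) None"
        by (auto simp: is_sink_def out_arcs_def rr_digraph_eq rotation_digraph_def)
      ultimately show ?thesis by blast
    next
      assume "\<exists>x. card (mates M y) = quota I y \<and> worst M y x \<and> cand F M x = {}"
      then obtain x where x: "card (mates M y) = quota I y" "worst M y x" "cand F M x = {}" by blast
      have "x \<in> agents I X" using mates_agents[OF yY, of M] MF inv(3) x(2) by (auto simp: worst_def)
      then have "is_sink (rr_digraph I X (M, F)) (Some x)"
        using sink_iff[OF inv(3) MF] x(3) by blast
      moreover have "(Some y, Some x) \<in> parcs (rr_digraph I X (M, F))"
        using arc_from_Y[OF inv(3) MF yY] x' b x(1,2) by (auto simp: rr_digraph_eq)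
      ultimately show ?thesis by blast
    qed
    moreover have "(Some x', Some y) \<in> parcs (rr_digraph I X (M, F))"
      using arc_from_X[OF inv(3) MF x'] b by (simp add: rr_digraph_eq)
    ultimately show ?thesis using rr_step.remove[OF x'] \<sigma> by blast
  qed
qed

text \<open>Legal assignments lie inside the final graph, so the absence of candidates there passes
  to each of them; the two comparison lemmas for empty candidate sets then treat X = B and X =
  A.\<close>

lemma halted_optimal:
  assumes "invariant X (M, F)" "rr_halted I X (M, F)"
  shows "optimal_in I (opposite X) (legal_assignments I) M"
proof -
  have inv: "M \<in> legal_assignments I" "\<Union>(legal_assignments I) \<subseteq> F" "F \<subseteq> edges I"
    using assms(1) by (auto simp: invariant_def)
  then have "M \<subseteq> F" by blast
  then have no_cand: "cand F M x = {}" if "x \<in> agents I X" for x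
    using that assms(2) arcs_empty_iff[OF inv(3)] by (auto simp: rr_halted_def rr_digraph_eq)
  have "cand M' M x = {}" if "M' \<in> legal_assignments I" "x \<in> agents I X" for M' x
    using cand_mono[of M' F M x] no_cand[OF that(2)] that(1) inv(2) by blast
  then show ?thesis
    using inv(1) legal_compatible[OF _ inv(1)] dominates_students_if_no_cand[of _ M]
      dominates_schools_if_no_cand[of _ M]
    by (cases X) auto
qed

end

theorem theorem5:
  fixes I :: "'v sa_instance" and X :: side
  assumes "stable_assignment_instance I"
  shows "rr_terminates I X \<and>
    (\<forall>M. rr_outputs I X M \<longrightarrow> optimal_in I (opposite X) (legal_assignments I) M)"
proof -
  interpret sa_instance I using assms by unfold_locales
  show ?thesis
    unfolding rr_terminates_def rr_outputs_def
    using no_infinite_run[of _ X] ex_step[of X] halted_optimal[of X] invariant_reachable[of X]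
      by blast
qed

end
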